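(* For every integer $s \geq 1$, the group $A_{2,s}$ is not finitely presentable.
   Context: For group elements write $g^h = hgh^{-1}$. For $r \ge 1$ and $s \ge 0$, let $F_{r,s}$ be a free group of rank $r+s$ with free basis $\{f_1, \ldots, f_r\} \cup \{y_1, \ldots, y_s\}$. The group $A_{r,s}$ is the group of bijections of the set of all tuples of the form $(u_1, \ldots, u_r, y_1, \ldots, y_s)$ with $u_1, \ldots, u_r \in F_{r,s}$ (equivalently, of the set $F_{r,s}^r$ of tuples $(u_1,\ldots,u_r)$) generated by the following transformations, each changing exactly one component: - $\mathrm{AC}_1(i,j)$: replaces $u_i$ by $u_i u_j$, where $1 \le i,j \le r$, $i \ne j$; - $\mathrm{AC}_2(i,j)$: replaces $u_i$ by $u_j u_i$, where $1 \le i,j \le r$, $i \ne j$; - $\mathrm{AC}_3(i)$: replaces $u_i$ by $u_i^{-1}$, where $1 \le i \le r$; - $\mathrm{AC}_4(i,k)$: replaces $u_i$ by $u_i^{y_k}$, where $1 \le i \le r$, $1 \le k \le s$. This group is antiisomorphic to the subgroup $\tilde A_{r,s}$ of $\mathrm{Aut}(F_{r,s})$ generated by all automorphisms that fix $y_1, \ldots, y_s$ and map the subgroup $\langle f_1, \ldots, f_r\rangle$ onto itself, together with the automorphisms $\xi_{i,k}$ ($1 \le i \le r$, $1 \le k \le s$) given by $f_i \mapsto f_i^{y_k}$ and fixing all other basis elements. *)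

theory Defs
  imports "HOL-Algebra.Algebra"
begin

text \<open>
  A letter is a pair \<open>(a, b)\<close>; it stands for the generator \<open>a\<close> if \<open>b = True\<close> and for its
  inverse if \<open>b = False\<close>. The free group on \<open>S\<close> is realised on the reduced words over \<open>S\<close>,
  with concatenation followed by free reduction as multiplication.
\<close>

type_synonym 'a letter = "'a \<times> bool"

definition flip :: "'a letter \<Rightarrow> 'a letter" where
  "flip x = (fst x, \<not> snd x)"

definition reduced :: "'a letter list \<Rightarrow> bool" where
  "reduced w \<longleftrightarrow> successively (\<lambda>x y. y \<noteq> flip x) w"

fun prepend :: "'a letter \<Rightarrow> 'a letter list \<Rightarrow> 'a letter list" where
  "prepend x [] = [x]"
| "prepend x (y # w) = (if y = flip x then w else x # y # w)"

definition free_group :: "'a set \<Rightarrow> 'a letter list monoid" where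
  "free_group S =
    \<lparr>carrier = {w. set w \<subseteq> S \<times> UNIV \<and> reduced w},
     monoid.mult = (\<lambda>u v. foldr prepend u v),
     one = []\<rparr>"

definition free_gen :: "'a \<Rightarrow> 'a letter list" where
  "free_gen a = [(a, True)]"

lemma flip_flip [simp]: "flip (flip x) = x"
  by (simp add: flip_def)

lemma flip_neq [simp]: "flip x \<noteq> x" "x \<noteq> flip x"
  by (auto simp: flip_def prod_eq_iff)

lemma flip_in_iff [simp]: "flip x \<in> S \<times> UNIV \<longleftrightarrow> x \<in> S \<times> UNIV"
  by (cases x) (auto simp: flip_def)

lemma reduced_Nil [simp]: "reduced []"
  by (simp add: reduced_def)

lemma reduced_Cons: "reduced (x # w) \<longleftrightarrow> reduced w \<and> (w = [] \<or> hd w \<noteq> flip x)"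
  by (cases w) (auto simp: reduced_def)

lemma reduced_prepend: "reduced w \<Longrightarrow> reduced (prepend x w)"
  by (cases w) (auto simp: reduced_Cons)

lemma reduced_foldr_prepend: "reduced w \<Longrightarrow> reduced (foldr prepend u w)"
  by (induction u) (auto intro: reduced_prepend)

lemma set_prepend: "set (prepend x w) \<subseteq> insert x (set w)"
  by (cases w) auto

lemma set_foldr_prepend: "set (foldr prepend u w) \<subseteq> set u \<union> set w"
  by (induction u) (use set_prepend in fastforce)+

lemma prepend_flip: "reduced w \<Longrightarrow> prepend (flip x) (prepend x w) = w"
proof (cases w)
  case (Cons y v)
  then show "reduced w \<Longrightarrow> prepend (flip x) (prepend x w) = w"
    by (cases v) (auto simp: reduced_Cons)
qed simp

lemma prepend_flip': "reduced w \<Longrightarrow> prepend x (prepend (flip x) w) = w"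
  using prepend_flip[of w "flip x"] by simp

lemma foldr_prepend_prepend:
  "reduced w \<Longrightarrow> foldr prepend (prepend x v) w = prepend x (foldr prepend v w)"
  by (cases v) (auto simp: prepend_flip' reduced_foldr_prepend)

lemma foldr_prepend_assoc:
  "reduced w \<Longrightarrow> foldr prepend (foldr prepend u v) w = foldr prepend u (foldr prepend v w)"
  by (induction u) (auto simp: foldr_prepend_prepend)

lemma foldr_prepend_Nil: "reduced u \<Longrightarrow> foldr prepend u [] = u"
proof (induction u)
  case (Cons x u)
  then show ?case by (cases u) (auto simp: reduced_Cons)
qed simp

lemma foldr_prepend_inverse:
  "reduced w \<Longrightarrow> foldr prepend (foldr prepend (rev (map flip u)) []) (foldr prepend u w) = w"
proof (induction u arbitrary: w)
  case (Cons x u)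
  have "foldr prepend (foldr prepend (rev (map flip u)) [flip x]) (prepend x (foldr prepend u w))
      = foldr prepend (rev (map flip u)) (prepend (flip x) (prepend x (foldr prepend u w)))"
    using Cons.prems
    by (subst foldr_prepend_assoc) (auto intro: reduced_prepend reduced_foldr_prepend)
  also have "\<dots> = foldr prepend (rev (map flip u)) (foldr prepend u w)"
    using Cons.prems by (simp add: prepend_flip reduced_foldr_prepend)
  also have "\<dots> = foldr prepend (foldr prepend (rev (map flip u)) []) (foldr prepend u w)"
    using Cons.prems by (subst foldr_prepend_assoc) (auto intro: reduced_foldr_prepend)
  finally show ?case
    using Cons by simp
qed simp

theorem group_free_group: "group (free_group S)"
proof (rule groupI)
  fix u v
  assume "u \<in> carrier (free_group S)" "v \<in> carrier (free_group S)"
  then show "u \<otimes>\<^bsub>free_group S\<^esub> v \<in> carrier (free_group S)"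
    using set_foldr_prepend[of u v] by (auto simp: free_group_def reduced_foldr_prepend)
next
  fix u assume u: "u \<in> carrier (free_group S)"
  let ?v = "foldr prepend (rev (map flip u)) []"
  have "set (map flip u) \<subseteq> S \<times> UNIV"
    using u by (auto simp: free_group_def flip_def)
  then have "?v \<in> carrier (free_group S)"
    using set_foldr_prepend[of "rev (map flip u)" "[]"]
    by (auto simp: free_group_def reduced_foldr_prepend)
  moreover have "?v \<otimes>\<^bsub>free_group S\<^esub> u = \<one>\<^bsub>free_group S\<^esub>"
    using u foldr_prepend_inverse[of "[]" u] by (simp add: free_group_def foldr_prepend_Nil)
  ultimately show "\<exists>v \<in> carrier (free_group S). v \<otimes>\<^bsub>free_group S\<^esub> u = \<one>\<^bsub>free_group S\<^esub>"
    by blast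
qed (auto simp: free_group_def foldr_prepend_assoc)

lemma free_gen_in_carrier [simp, intro]: "a \<in> S \<Longrightarrow> free_gen a \<in> carrier (free_group S)"
  by (auto simp: free_gen_def free_group_def reduced_Cons)

lemma inv_free_gen: "a \<in> S \<Longrightarrow> inv\<^bsub>free_group S\<^esub> (free_gen a) = [(a, False)]"
  by (rule group.inv_equality[OF group_free_group])
     (auto simp: free_gen_def free_group_def reduced_Cons flip_def)

theorem free_group_universal:
  assumes G: "group G" and \<phi>: "\<phi> \<in> S \<rightarrow> carrier G"
  shows "\<exists>h \<in> hom (free_group S) G. (\<forall>a \<in> S. h (free_gen a) = \<phi> a) \<and>
           (\<forall>k \<in> hom (free_group S) G. (\<forall>a \<in> S. k (free_gen a) = \<phi> a) \<longrightarrow>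
              (\<forall>w \<in> carrier (free_group S). k w = h w))"
proof -
  interpret G: group G by fact
  let ?F = "free_group S"
  interpret F: group ?F by (rule group_free_group)
  define l where "l x = (if snd x then \<phi> (fst x) else inv\<^bsub>G\<^esub> \<phi> (fst x))" for x
  define h where "h w = foldr (\<lambda>x g. l x \<otimes>\<^bsub>G\<^esub> g) w \<one>\<^bsub>G\<^esub>" for w
  have l: "l x \<in> carrier G" if "x \<in> S \<times> UNIV" for x
    using that \<phi> by (auto simp: l_def)
  have hc: "h w \<in> carrier G" if "set w \<subseteq> S \<times> UNIV" for w
    using that by (induction w) (auto simp: h_def l)
  have lf: "l x \<otimes>\<^bsub>G\<^esub> (l (flip x) \<otimes>\<^bsub>G\<^esub> g) = g"
    if "x \<in> S \<times> UNIV" "g \<in> carrier G" for x g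
    using that \<phi>
    by (auto simp: l_def flip_def Pi_iff simp flip: G.m_assoc)
  have hp: "h (prepend x w) = l x \<otimes>\<^bsub>G\<^esub> h w"
    if "x \<in> S \<times> UNIV" "set w \<subseteq> S \<times> UNIV" for x w
  proof (cases w)
    case (Cons y v)
    then have "h w = l y \<otimes>\<^bsub>G\<^esub> h v" "h v \<in> carrier G"
      using that hc[of v] by (auto simp: h_def)
    then show ?thesis
      using Cons that lf[of x "h v"] by (auto simp: h_def)
  qed (simp add: h_def)
  have hm: "h (foldr prepend u v) = h u \<otimes>\<^bsub>G\<^esub> h v"
    if "set u \<subseteq> S \<times> UNIV" "set v \<subseteq> S \<times> UNIV" for u v
    using that(1)
  proof (induction u)
    case Nil
    then show ?case using hc[OF that(2)] by (simp add: h_def)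
  next
    case (Cons x u)
    have "set (foldr prepend u v) \<subseteq> S \<times> UNIV"
      using Cons.prems that(2) set_foldr_prepend[of u v] by auto
    moreover have "h (x # u) = l x \<otimes>\<^bsub>G\<^esub> h u"
      by (simp add: h_def)
    ultimately show ?case
      using Cons hp[of x "foldr prepend u v"] hc[of u] hc[OF that(2)] l[of x]
      by (simp add: G.m_assoc)
  qed
  have hom: "h \<in> hom ?F G"
    by (rule homI) (auto simp: free_group_def hc hm)
  have gen: "h (free_gen a) = \<phi> a" if "a \<in> S" for a
    using that \<phi> by (auto simp: h_def free_gen_def l_def Pi_iff)
  have "k w = h w"
    if k: "k \<in> hom ?F G" and ka: "\<forall>a \<in> S. k (free_gen a) = \<phi> a"
      and w: "w \<in> carrier ?F" for k w
    using w
  proof (induction w)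
    case Nil
    have "k \<one>\<^bsub>?F\<^esub> = \<one>\<^bsub>G\<^esub>" by (rule hom_one[OF k F.is_group G])
    then show ?case by (simp add: h_def free_group_def)
  next
    case (Cons x w)
    then have x: "[x] \<in> carrier ?F" and w: "w \<in> carrier ?F" and S: "fst x \<in> S"
      by (auto simp: free_group_def reduced_Cons)
    have "x # w = [x] \<otimes>\<^bsub>?F\<^esub> w"
      using Cons.prems by (cases w) (auto simp: free_group_def reduced_Cons)
    then have "k (x # w) = k [x] \<otimes>\<^bsub>G\<^esub> k w"
      using hom_mult[OF k x w] by simp
    moreover have "k [x] = l x"
    proof (cases "snd x")
      case True
      then have "[x] = free_gen (fst x)" by (simp add: free_gen_def prod_eq_iff)
      then show ?thesis using True ka S by (simp add: l_def)
    next
      case False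
      then have "[x] = inv\<^bsub>?F\<^esub> (free_gen (fst x))"
        using S by (simp add: inv_free_gen prod_eq_iff)
      moreover interpret k: group_hom ?F G k
        by unfold_locales (rule k)
      have "k (inv\<^bsub>?F\<^esub> (free_gen (fst x))) = inv\<^bsub>G\<^esub> k (free_gen (fst x))"
        using S by (intro k.hom_inv) auto
      ultimately show ?thesis using False ka S by (simp add: l_def)
    qed
    ultimately show ?case
      using Cons.IH[OF w] by (simp add: h_def)
  qed
  with hom gen show ?thesis by blast
qed

definition normal_closure :: "('a, 'b) monoid_scheme \<Rightarrow> 'a set \<Rightarrow> 'a set" where
  "normal_closure G R = \<Inter> {N. N \<lhd> G \<and> R \<subseteq> N}"

text \<open>Taking the generating symbols in \<^typ>\<open>nat\<close> is no restriction, as they are finite in number.\<close>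

definition finitely_presentable :: "('a, 'b) monoid_scheme \<Rightarrow> bool" where
  "finitely_presentable G \<longleftrightarrow>
    (\<exists>(S :: nat set) R. finite S \<and> finite R \<and> R \<subseteq> carrier (free_group S) \<and>
       G \<cong> free_group S Mod normal_closure (free_group S) R)"

lemma (in group) normal_closure_normal:
  assumes "R \<subseteq> carrier G"
  shows "normal_closure G R \<lhd> G"
proof -
  have ne: "{N. N \<lhd> G \<and> R \<subseteq> N} \<noteq> {}"
    using assms normal_inv_iff subgroup_self by blast
  have "subgroup (normal_closure G R) G"
    unfolding normal_closure_def
    by (rule subgroups_Inter[OF _ ne]) (auto simp: normal_imp_subgroup)
  then show ?thesis
    by (auto simp: normal_inv_iff normal_closure_def)
qed

datatype basis_symbol = Fsym nat | Ysym nat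

definition F_group :: "nat \<Rightarrow> nat \<Rightarrow> basis_symbol letter list monoid" where
  "F_group r s = free_group (Fsym ` {1..r} \<union> Ysym ` {1..s})"

definition y_gen :: "nat \<Rightarrow> basis_symbol letter list" where
  "y_gen k = free_gen (Ysym k)"

text \<open>
  The constant components \<open>y\<^sub>1, \<dots>, y\<^sub>s\<close> of a tuple are omitted: a tuple is given by
  \<open>(u\<^sub>1, \<dots>, u\<^sub>r)\<close>, represented by the function \<open>i \<mapsto> u\<^sub>i\<close>.
\<close>

definition tuples :: "nat \<Rightarrow> nat \<Rightarrow> (nat \<Rightarrow> basis_symbol letter list) set" where
  "tuples r s = {1..r} \<rightarrow>\<^sub>E carrier (F_group r s)"

definition AC1 where
  "AC1 r s i j = (\<lambda>u \<in> tuples r s. u(i := u i \<otimes>\<^bsub>F_group r s\<^esub> u j))"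

definition AC2 where
  "AC2 r s i j = (\<lambda>u \<in> tuples r s. u(i := u j \<otimes>\<^bsub>F_group r s\<^esub> u i))"

definition AC3 where
  "AC3 r s i = (\<lambda>u \<in> tuples r s. u(i := inv\<^bsub>F_group r s\<^esub> u i))"

definition AC4 where
  "AC4 r s i k = (\<lambda>u \<in> tuples r s.
     u(i := y_gen k \<otimes>\<^bsub>F_group r s\<^esub> u i \<otimes>\<^bsub>F_group r s\<^esub> inv\<^bsub>F_group r s\<^esub> y_gen k))"

definition AC_transformations ::
  "nat \<Rightarrow> nat \<Rightarrow> ((nat \<Rightarrow> basis_symbol letter list) \<Rightarrow> (nat \<Rightarrow> basis_symbol letter list)) set" where
  "AC_transformations r s =
     {AC1 r s i j | i j. i \<in> {1..r} \<and> j \<in> {1..r} \<and> i \<noteq> j} \<union>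
     {AC2 r s i j | i j. i \<in> {1..r} \<and> j \<in> {1..r} \<and> i \<noteq> j} \<union>
     {AC3 r s i | i. i \<in> {1..r}} \<union>
     {AC4 r s i k | i k. i \<in> {1..r} \<and> k \<in> {1..s}}"

definition A_group ::
  "nat \<Rightarrow> nat \<Rightarrow> ((nat \<Rightarrow> basis_symbol letter list) \<Rightarrow> (nat \<Rightarrow> basis_symbol letter list)) monoid" where
  "A_group r s =
     (BijGroup (tuples r s))
       \<lparr>carrier := generate (BijGroup (tuples r s)) (AC_transformations r s)\<rparr>"

lemma group_F_group: "group (F_group r s)"
  by (simp add: F_group_def group_free_group)

lemma update_in_Bij:
  assumes i: "i \<in> {1..r}"
    and t: "\<And>u. u \<in> tuples r s \<Longrightarrow> t u \<in> carrier (F_group r s)"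
    and t': "\<And>u. u \<in> tuples r s \<Longrightarrow> t' u \<in> carrier (F_group r s)"
    and 1: "\<And>u. u \<in> tuples r s \<Longrightarrow> t' (u(i := t u)) = u i"
    and 2: "\<And>u. u \<in> tuples r s \<Longrightarrow> t (u(i := t' u)) = u i"
  shows "(\<lambda>u \<in> tuples r s. u(i := t u)) \<in> Bij (tuples r s)"
proof -
  have upd: "u(i := g) \<in> tuples r s" if "u \<in> tuples r s" "g \<in> carrier (F_group r s)" for u g
    using that i by (auto simp: tuples_def PiE_iff extensional_def)
  have "bij_betw (\<lambda>u \<in> tuples r s. u(i := t u)) (tuples r s) (tuples r s)"
    by (rule bij_betw_byWitness[where f' = "\<lambda>u. u(i := t' u)"])
       (auto simp: upd t t' 1 2)
  then show ?thesis by (simp add: Bij_def)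
qed

lemma AC_transformations_subset: "AC_transformations r s \<subseteq> carrier (BijGroup (tuples r s))"
proof -
  interpret F: group "F_group r s" by (rule group_F_group)
  have u: "u i \<in> carrier (F_group r s)" if "u \<in> tuples r s" "i \<in> {1..r}" for u i
    using that by (auto simp: tuples_def)
  have y: "y_gen k \<in> carrier (F_group r s)" if "k \<in> {1..s}" for k
    using that by (auto simp: y_gen_def F_group_def)
  have "AC1 r s i j \<in> Bij (tuples r s)" if "i \<in> {1..r}" "j \<in> {1..r}" "i \<noteq> j" for i j
    unfolding AC1_def
    by (rule update_in_Bij[where t' = "\<lambda>u. u i \<otimes>\<^bsub>F_group r s\<^esub> inv\<^bsub>F_group r s\<^esub> u j"])
       (use that in \<open>simp_all add: u F.m_assoc del: atLeastAtMost_iff\<close>)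
  moreover have "AC2 r s i j \<in> Bij (tuples r s)" if "i \<in> {1..r}" "j \<in> {1..r}" "i \<noteq> j" for i j
    unfolding AC2_def
    by (rule update_in_Bij[where t' = "\<lambda>u. inv\<^bsub>F_group r s\<^esub> u j \<otimes>\<^bsub>F_group r s\<^esub> u i"])
       (use that in \<open>simp_all add: u del: atLeastAtMost_iff flip: F.m_assoc\<close>)
  moreover have "AC3 r s i \<in> Bij (tuples r s)" if "i \<in> {1..r}" for i
    unfolding AC3_def
    by (rule update_in_Bij[where t' = "\<lambda>u. inv\<^bsub>F_group r s\<^esub> u i"])
       (use that in \<open>simp_all add: u del: atLeastAtMost_iff\<close>)
  moreover have "AC4 r s i k \<in> Bij (tuples r s)" if "i \<in> {1..r}" "k \<in> {1..s}" for i k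
  proof -
    have c1: "inv\<^bsub>F_group r s\<^esub> y_gen k \<otimes>\<^bsub>F_group r s\<^esub> (y_gen k \<otimes>\<^bsub>F_group r s\<^esub> g) = g"
      and c2: "y_gen k \<otimes>\<^bsub>F_group r s\<^esub> (inv\<^bsub>F_group r s\<^esub> y_gen k \<otimes>\<^bsub>F_group r s\<^esub> g) = g"
      if "g \<in> carrier (F_group r s)" for g
      using that y[OF \<open>k \<in> {1..s}\<close>] by (simp_all flip: F.m_assoc)
    show ?thesis
      unfolding AC4_def
      by (rule update_in_Bij[where
            t' = "\<lambda>u. inv\<^bsub>F_group r s\<^esub> y_gen k \<otimes>\<^bsub>F_group r s\<^esub> u i \<otimes>\<^bsub>F_group r s\<^esub> y_gen k"])
         (use that in \<open>simp_all add: u y F.m_assoc c1 c2 del: atLeastAtMost_iff\<close>)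
  qed
  ultimately show ?thesis
    by (auto simp: AC_transformations_def BijGroup_def)
qed

theorem group_A_group: "group (A_group r s)"
  unfolding A_group_def
  by (intro subgroup.subgroup_is_group group.generate_is_subgroup
        group_BijGroup AC_transformations_subset)

end

theory Submission
  imports Defs "HOL-Library.Z2" "HOL-Library.Nat_Bijection"
    "HOL-Computational_Algebra.Polynomial_Factorial"
begin

text \<open>
  Modulo 2 and with every \<open>y\<^sub>k\<close> sent to \<open>t\<close>, the group acts on pairs of Laurent polynomials over the field with two
  elements: \<open>AC\<^sub>1(1,2)\<close> and \<open>AC\<^sub>2(1,2)\<close> both become the elementary matrix \<open>x\<close>, and \<open>AC\<^sub>4(1,k)\<close> becomes
  \<open>D = diag(t, 1)\<close>. In the group, \<open>AC\<^sub>2(1,2)\<close> commutes with all conjugates of \<open>AC\<^sub>1(1,2)\<close> by powers of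
  \<open>AC\<^sub>4(1,1)\<close>, since one multiplies from the left and the others from the right.

  The image in \<open>PGL\<^sub>2\<close> of the Laurent polynomials is presented by \<open>S\<^sup>2 = x\<^sup>2 = (S x)\<^sup>3 = 1\<close>, \<open>S D S = D\<^sup>-\<^sup>1\<close> and
  \<open>[x, D\<^sup>i x D\<^sup>-\<^sup>i] = 1\<close> for all \<open>i\<close>. For each \<open>N\<close> there are permutations satisfying these relations
  for \<open>i \<le> N\<close> but not for \<open>i = N + 1\<close>. Hence the class of the sequence of these permutations, modulo
  eventual equality, receives a homomorphism from the Andrews-Curtis group. If that group were finitely
  presentable, the homomorphism would lift to a genuine one to the \<open>N\<close>-th permutation group for all large
  \<open>N\<close>, and the commutation above would force the relation for \<open>i = N + 1\<close>.
\<close>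

section \<open>Finite presentability and asymptotic homomorphisms\<close>

lemma (in group) normal_closure_subset:
  assumes "N \<lhd> G" "R \<subseteq> N"
  shows "normal_closure G R \<subseteq> N"
  using assms by (auto simp: normal_closure_def)

text \<open>Each product rule for \<open>\<psi>\<close> holds only from an index on that depends on
  the two factors. A finite presentation makes finitely many thresholds suffice: those of the
  relators and of the elements of \<open>T\<close>.\<close>

lemma finitely_presentable_eventually_hom:
  assumes G: "group G" and fp: "finitely_presentable G" and H: "group H"
    and closed: "\<And>g. g \<in> carrier G \<Longrightarrow> eventually (\<lambda>n :: nat. \<psi> g n \<in> carrier H) sequentially"
    and mult: "\<And>g h. g \<in> carrier G \<Longrightarrow> h \<in> carrier G \<Longrightarrow>
      eventually (\<lambda>n. \<psi> (g \<otimes>\<^bsub>G\<^esub> h) n = \<psi> g n \<otimes>\<^bsub>H\<^esub> \<psi> h n) sequentially"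
    and T: "finite T" "T \<subseteq> carrier G"
  shows "eventually (\<lambda>n. \<exists>\<chi> \<in> hom G H. \<forall>g \<in> T. \<chi> g = \<psi> g n) sequentially"
proof -
  interpret G: group G by (rule G)
  interpret H: group H by (rule H)
  obtain S :: "nat set" and R where S: "finite S" "finite R" "R \<subseteq> carrier (free_group S)"
    and iso: "G \<cong> free_group S Mod normal_closure (free_group S) R"
    using fp by (auto simp: finitely_presentable_def)
  define F where "F = free_group S"
  define K where "K = normal_closure F R"
  interpret F: group F unfolding F_def by (rule group_free_group)
  interpret K: normal K F
    unfolding K_def using S(3) by (intro F.normal_closure_normal) (simp add: F_def)
  have Q: "group (F Mod K)" by (rule K.factorgroup_is_group)
  obtain \<theta> where \<theta>: "\<theta> \<in> iso (F Mod K) G"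
    using G.iso_sym[OF iso] unfolding is_iso_def F_def[symmetric] K_def[symmetric] by blast
  \<comment> \<open>\<open>p\<close> is the projection of the free group followed by the
    isomorphism, so it maps onto \<open>G\<close> with kernel \<open>K\<close>.\<close>
  define p where "p w = \<theta> (K #>\<^bsub>F\<^esub> w)" for w
  have p: "p \<in> hom F G"
    using hom_compose[OF K.r_coset_hom_Mod, of \<theta> G] \<theta> by (simp add: iso_def p_def[abs_def] o_def)
  have p_closed: "p w \<in> carrier G" if "w \<in> carrier F" for w
    using p that by (auto simp: hom_def)
  have p_mult: "p (v \<otimes>\<^bsub>F\<^esub> w) = p v \<otimes>\<^bsub>G\<^esub> p w" if "v \<in> carrier F" "w \<in> carrier F" for v w
    using p that by (auto simp: hom_def)
  have p_surj: "\<exists>w \<in> carrier F. p w = g" if g: "g \<in> carrier G" for g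
  proof -
    have "g \<in> \<theta> ` carrier (F Mod K)" using \<theta> g by (auto simp: iso_def bij_betw_def)
    then show ?thesis by (auto simp: FactGroup_def RCOSETS_def p_def)
  qed
  have p_ker: "w \<in> K" if w: "w \<in> carrier F" "p w = \<one>\<^bsub>G\<^esub>" for w
  proof -
    have "\<theta> K = \<one>\<^bsub>G\<^esub>"
      using hom_one[OF _ Q G, of \<theta>] \<theta> by (simp add: iso_def)
    moreover have "inj_on \<theta> (carrier (F Mod K))" using \<theta> by (auto simp: iso_def bij_betw_def)
    moreover have "K \<in> carrier (F Mod K)"
      using group.is_monoid[OF Q] monoid.one_closed by fastforce
    moreover have "K #>\<^bsub>F\<^esub> w \<in> carrier (F Mod K)"
      using w(1) by (auto simp: FactGroup_def RCOSETS_def)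
    ultimately have "K #>\<^bsub>F\<^esub> w = K" using w(2) by (auto simp: p_def inj_on_def)
    then show ?thesis using F.rcos_self[OF w(1) K.subgroup_axioms] by simp
  qed
  have p_K: "p w = \<one>\<^bsub>G\<^esub>" if "w \<in> K" for w
  proof -
    have "K #>\<^bsub>F\<^esub> w = K" using that by (simp add: K.rcos_const)
    then show ?thesis
      using hom_one[OF _ Q G, of \<theta>] \<theta> by (simp add: iso_def p_def)
  qed
  \<comment> \<open>The identity serves as default where \<open>\<psi>\<close> still leaves
    \<open>H\<close>, so that the universal property applies for every \<open>n\<close>.\<close>
  define \<phi> where "\<phi> n a = (let h = \<psi> (p (free_gen a)) n in if h \<in> carrier H then h else \<one>\<^bsub>H\<^esub>)" for n a
  have "\<exists>k \<in> hom F H. \<forall>a \<in> S. k (free_gen a) = \<phi> n a" for n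
  proof -
    have "\<phi> n \<in> S \<rightarrow> carrier H" by (auto simp: \<phi>_def Let_def)
    from free_group_universal[OF H this] show ?thesis unfolding F_def by (elim bexE conjE) (rule bexI)
  qed
  then obtain k where k: "\<And>n. k n \<in> hom F H" "\<And>n a. a \<in> S \<Longrightarrow> k n (free_gen a) = \<phi> n a"
    by metis
  have k_mult: "k n (v \<otimes>\<^bsub>F\<^esub> w) = k n v \<otimes>\<^bsub>H\<^esub> k n w" if "v \<in> carrier F" "w \<in> carrier F" for n v w
    using k(1)[of n] that by (auto simp: hom_def)
  \<comment> \<open>An idempotent of a group is the identity.\<close>
  have \<psi>_one: "eventually (\<lambda>n. \<psi> \<one>\<^bsub>G\<^esub> n = \<one>\<^bsub>H\<^esub>) sequentially"
    using closed[OF G.one_closed] mult[OF G.one_closed G.one_closed]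
    by eventually_elim (metis G.l_one G.one_closed H.l_cancel_one')
  have gen: "eventually (\<lambda>n. k n (free_gen a) = \<psi> (p (free_gen a)) n) sequentially" if "a \<in> S" for a
  proof -
    have "free_gen a \<in> carrier F" using that by (simp add: F_def free_gen_in_carrier)
    then have "eventually (\<lambda>n. \<psi> (p (free_gen a)) n \<in> carrier H) sequentially"
      by (intro closed p_closed)
    then show ?thesis by eventually_elim (simp add: k(2) that \<phi>_def)
  qed
  have letter: "eventually (\<lambda>n. k n [x] = \<psi> (p [x]) n) sequentially" if x: "fst x \<in> S" for x
  proof (cases "snd x")
    case True
    then have "[x] = free_gen (fst x)" by (simp add: free_gen_def prod_eq_iff)
    then show ?thesis using gen[OF x] by simp
  next
    case False
    define a where "a = free_gen (fst x)"
    have a: "a \<in> carrier F" using x by (simp add: F_def a_def free_gen_in_carrier)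
    have inv: "[x] = inv\<^bsub>F\<^esub> a"
      using x False by (simp add: F_def a_def inv_free_gen prod_eq_iff)
    have pi: "p [x] = inv\<^bsub>G\<^esub> p a"
      unfolding inv using group_hom.hom_inv[of F G p a] a p
      by (simp add: group_hom_def group_hom_axioms_def F.is_group G)
    have ki: "k n [x] = inv\<^bsub>H\<^esub> k n a" for n
      unfolding inv using group_hom.hom_inv[of F H "k n" a] a k(1)
      by (simp add: group_hom_def group_hom_axioms_def F.is_group H)
    have "p a \<in> carrier G" "p [x] \<in> carrier G" using a pi p_closed by auto
    then have "eventually (\<lambda>n. \<psi> (p [x] \<otimes>\<^bsub>G\<^esub> p a) n = \<psi> (p [x]) n \<otimes>\<^bsub>H\<^esub> \<psi> (p a) n) sequentially"
      "eventually (\<lambda>n. \<psi> (p [x]) n \<in> carrier H) sequentially"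
      "eventually (\<lambda>n. \<psi> (p a) n \<in> carrier H) sequentially"
      by (auto intro: mult closed)
    then show ?thesis
      using gen[OF x] \<psi>_one unfolding a_def[symmetric]
    proof eventually_elim
      case (elim n)
      have "p [x] \<otimes>\<^bsub>G\<^esub> p a = \<one>\<^bsub>G\<^esub>" using pi \<open>p a \<in> carrier G\<close> by simp
      with elim show ?case by (metis H.inv_equality ki)
    qed
  qed
  have word: "eventually (\<lambda>n. k n w = \<psi> (p w) n) sequentially" if "w \<in> carrier F" for w
    using that
  proof (induction w)
    case Nil
    have Nil: "[] = \<one>\<^bsub>F\<^esub>" by (simp add: F_def free_group_def)
    have "p [] = \<one>\<^bsub>G\<^esub>" "k n [] = \<one>\<^bsub>H\<^esub>" for n
      unfolding Nil by (rule hom_one[OF p F.is_group G], rule hom_one[OF k(1) F.is_group H])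
    then show ?case using \<psi>_one by (simp add: eq_commute)
  next
    case (Cons x w)
    then have x: "[x] \<in> carrier F" and w: "w \<in> carrier F" and xS: "fst x \<in> S"
      by (auto simp: F_def free_group_def reduced_Cons)
    have xw: "x # w = [x] \<otimes>\<^bsub>F\<^esub> w"
      using Cons.prems by (cases w) (auto simp: F_def free_group_def reduced_Cons)
    show ?case
      using Cons.IH[OF w] letter[OF xS] mult[OF p_closed[OF x] p_closed[OF w]]
      unfolding xw by eventually_elim (simp add: k_mult p_mult x w)
  qed
  have "eventually (\<lambda>n. k n r = \<one>\<^bsub>H\<^esub>) sequentially" if "r \<in> R" for r
  proof -
    have "r \<in> K" using that by (auto simp: K_def normal_closure_def)
    then have "p r = \<one>\<^bsub>G\<^esub>" by (rule p_K)
    moreover have "r \<in> carrier F" using that S(3) by (auto simp: F_def)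
    ultimately show ?thesis
      using word[of r] \<psi>_one by (auto elim: eventually_elim2)
  qed
  then have ev_R: "eventually (\<lambda>n. \<forall>r \<in> R. k n r = \<one>\<^bsub>H\<^esub>) sequentially"
    using S(2) by (simp add: eventually_ball_finite)
  \<comment> \<open>An arbitrary section of \<open>p\<close>; once \<open>k n\<close> kills
    \<open>K\<close>, the choice no longer affects \<open>k n (lift g)\<close>.\<close>
  obtain lift where lift: "\<And>g. g \<in> carrier G \<Longrightarrow> lift g \<in> carrier F" "\<And>g. g \<in> carrier G \<Longrightarrow> p (lift g) = g"
    using p_surj by metis
  have "eventually (\<lambda>n. \<forall>g \<in> T. k n (lift g) = \<psi> g n) sequentially"
    using T lift word by (intro eventually_ball_finite) (auto, metis in_mono)
  with ev_R show ?thesis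
  proof eventually_elim
    case (elim n)
    interpret k: group_hom F H "k n"
      by unfold_locales (rule k(1))
    have "K \<subseteq> kernel F H (k n)"
      unfolding K_def using elim(1) S(3)
      by (intro F.normal_closure_subset k.normal_kernel) (auto simp: kernel_def F_def)
    then have K1: "k n w = \<one>\<^bsub>H\<^esub>" if "w \<in> K" for w
      using that by (auto simp: kernel_def)
    have eq: "k n v = k n w" if vw: "v \<in> carrier F" "w \<in> carrier F" "p v = p w" for v w
    proof -
      have "p (v \<otimes>\<^bsub>F\<^esub> inv\<^bsub>F\<^esub> w) = \<one>\<^bsub>G\<^esub>"
        using vw group_hom.hom_inv[of F G p w] p p_closed
        by (simp add: p_mult group_hom_def group_hom_axioms_def F.is_group G)
      then have "k n (v \<otimes>\<^bsub>F\<^esub> inv\<^bsub>F\<^esub> w) = \<one>\<^bsub>H\<^esub>"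
        using vw by (intro K1 p_ker) auto
      then show ?thesis using vw H.inv_equality[of "k n v" "inv\<^bsub>H\<^esub> k n w"] by simp
    qed
    have "(\<lambda>g. k n (lift g)) \<in> hom G H"
    proof (rule homI)
      fix g h assume g: "g \<in> carrier G" "h \<in> carrier G"
      then have "k n (lift (g \<otimes>\<^bsub>G\<^esub> h)) = k n (lift g \<otimes>\<^bsub>F\<^esub> lift h)"
        by (intro eq) (auto simp: lift p_mult)
      then show "k n (lift (g \<otimes>\<^bsub>G\<^esub> h)) = k n (lift g) \<otimes>\<^bsub>H\<^esub> k n (lift h)"
        using g by (simp add: lift)
    qed (auto simp: lift)
    then show ?case using elim(2) by (intro bexI[of _ "\<lambda>g. k n (lift g)"])
  qed
qed

section \<open>Permutations satisfying a truncated system of relations\<close>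

unbundle bit_operations_syntax

type_synonym point = "nat \<times> nat \<times> bool"

text \<open>
  In \<open>(j, m, b)\<close> the binary digits of \<open>j\<close> record which of the involutions \<open>shift (2 ^ i)\<close> have been
  applied; the bijection \<open>enc\<close> from the points with \<open>j \<noteq> 0\<close> onto the naturals makes room for an involution
  satisfying the braid relation with \<open>flip_sign N\<close>.
\<close>

definition enc :: "point \<Rightarrow> nat" where
  "enc = (\<lambda>(j, m, b). prod_encode (j - 1, 2 * m + of_bool b))"

definition dec :: "nat \<Rightarrow> point" where
  "dec k = (let (i, l) = prod_decode k in (Suc i, l div 2, odd l))"

lemma enc_dec [simp]: "enc (dec k) = k"
proof -
  have "2 * (l div 2) + of_bool (odd l) = l" for l :: nat
    by (cases "even l") auto
  then show ?thesis
    by (cases "prod_decode k") (auto simp: enc_def dec_def prod_encode_inverse simp flip: prod_encode_eq)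
qed

lemma dec_enc [simp]: "j \<noteq> 0 \<Longrightarrow> dec (enc (j, m, b)) = (j, m, b)"
  by (auto simp: enc_def dec_def)

lemma fst_dec [simp]: "fst (dec k) \<noteq> 0"
  by (auto simp: dec_def split: prod.splits)

definition shift :: "nat \<Rightarrow> point \<Rightarrow> point" where
  "shift k = (\<lambda>(j, m, b). (j XOR k, m, b))"

text \<open>The sign is reversed exactly where digit \<open>N\<close> of \<open>j\<close> is 0, so a
  shift commutes with this map unless it changes digit \<open>N\<close>.\<close>

definition flip_sign :: "nat \<Rightarrow> point \<Rightarrow> point" where
  "flip_sign N = (\<lambda>(j, m, b). (j, m, b = bit j N))"

fun reflect :: "nat \<Rightarrow> point \<Rightarrow> point" where
  "reflect N (j, m, b) =
    (if j \<noteq> 0 then (0, enc (j, m, b), False)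
     else if b then (0, enc (flip_sign N (dec m)), True)
     else dec m)"

lemma flip_sign_flip_sign [simp]: "flip_sign N (flip_sign N z) = z"
  by (auto simp: flip_sign_def split: prod.splits)

lemma fst_flip_sign [simp]: "fst (flip_sign N z) = fst z"
  by (auto simp: flip_sign_def split: prod.splits)

lemma dec_enc' [simp]: "fst z \<noteq> 0 \<Longrightarrow> dec (enc z) = z"
  by (cases z) auto

lemma reflect_nz: "fst z \<noteq> 0 \<Longrightarrow> reflect N z = (0, enc z, False)"
  by (cases z) auto

lemma reflect_reflect [simp]: "reflect N (reflect N z) = z"
  by (cases z) (auto simp: reflect_nz)

lemma flip_sign_0: "flip_sign N (0, m, b) = (0, m, \<not> b)"
  by (auto simp: flip_sign_def)

text \<open>Up to \<open>enc\<close> there are three copies of the set of points with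
  \<open>j \<noteq> 0\<close>: this set, the points \<open>(0, m, False)\<close> and the points
  \<open>(0, m, True)\<close>. \<open>reflect N\<close> exchanges the first two and
  \<open>flip_sign N\<close> the last two, each acting as \<open>flip_sign N\<close> on the
  remaining copy. The braid relation of two adjacent transpositions carries over, with one twist on
  each copy on both sides.\<close>

lemma braid: "reflect N (flip_sign N (reflect N z)) = flip_sign N (reflect N (flip_sign N z))"
proof (cases z)
  case (fields j m b)
  show ?thesis
  proof (cases "j = 0")
    case True
    then show ?thesis
      by (cases b) (auto simp: fields flip_sign_0 reflect_nz)
  next
    case False
    then show ?thesis
      by (simp add: fields flip_sign_0 reflect_nz)
  qed
qed

lemma shift_shift: "shift k (shift l z) = shift (k XOR l) z"
  by (auto simp: shift_def ac_simps split: prod.splits)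

lemma shift_self [simp]: "shift k (shift k z) = z"
  by (auto simp: shift_def xor.assoc split: prod.splits)

lemma shift_flip_sign: "\<not> bit k N \<Longrightarrow> shift k (flip_sign N z) = flip_sign N (shift k z)"
  by (auto simp: shift_def flip_sign_def bit_xor_iff split: prod.splits)

text \<open>
  The binary digits of \<open>k\<close> select a subset of \<open>{0..N}\<close>: \<open>e_elt N k\<close> is the product of the \<open>x_elt N i\<close>
  below over this subset, and \<open>f_elt N k\<close> is the product of the conjugates of the \<open>x_elt N (i + 1)\<close> by
  \<open>reflect N\<close>. The two families generate a free product (ping-pong between \<open>pong_set\<close> and its complement),
  so exchanging them is an automorphism; \<open>swap_coset\<close> realises it by a permutation, by letting the free
  product act on the permutations of \<open>point\<close> and choosing coset representatives.
\<close>

definition small :: "nat \<Rightarrow> nat \<Rightarrow> bool" where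
  "small N k \<longleftrightarrow> (\<forall>i > N. \<not> bit k i)"

definition e_elt :: "nat \<Rightarrow> nat \<Rightarrow> point \<Rightarrow> point" where
  "e_elt N k = (if odd k then flip_sign N else id) \<circ> shift (k div 2)"

definition f_elt :: "nat \<Rightarrow> nat \<Rightarrow> point \<Rightarrow> point" where
  "f_elt N k = reflect N \<circ> shift k \<circ> reflect N"

lemma small_xor: "small N k \<Longrightarrow> small N l \<Longrightarrow> small N (k XOR l)"
  by (auto simp: small_def bit_xor_iff)

lemma xor_div_2: "(k XOR l) div 2 = (k div 2) XOR (l div 2)" for k l :: nat
  by (rule bit_eqI) (simp add: bit_xor_iff flip: bit_Suc)

lemma small_div_2: "small N k \<Longrightarrow> \<not> bit (k div 2) N"
  by (auto simp: small_def simp flip: bit_Suc)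

text \<open>\<open>small\<close> allows digits up to \<open>N\<close> in \<open>k\<close>, hence
  only digits below \<open>N\<close> in \<open>k div 2\<close>; the shifts involved then commute
  with \<open>flip_sign N\<close>.\<close>

lemma e_elt_mult: "small N k \<Longrightarrow> small N l \<Longrightarrow> e_elt N k \<circ> e_elt N l = e_elt N (k XOR l)"
  using small_div_2[of N k] small_div_2[of N l]
  by (auto simp: e_elt_def fun_eq_iff shift_shift shift_flip_sign xor_div_2 even_xor_iff)

lemma f_elt_mult: "f_elt N k \<circ> f_elt N l = f_elt N (k XOR l)"
  by (auto simp: f_elt_def fun_eq_iff shift_shift)

lemma e_elt_0 [simp]: "e_elt N 0 = id" and f_elt_0 [simp]: "f_elt N 0 = id"
  by (auto simp: e_elt_def f_elt_def shift_def fun_eq_iff)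

section \<open>Ping-pong for the two families\<close>

definition pong_set :: "point set" where
  "pong_set = {(0, m, False) | m. True}"

text \<open>No shift occurring in an \<open>e_elt N k\<close> with \<open>small N k\<close> touches
  digit \<open>N + 1\<close>, so such a map cannot confuse this point with one where
  \<open>j = 0\<close>.\<close>

definition base :: "nat \<Rightarrow> point" where
  "base N = (2 ^ Suc N, 0, True)"

lemma base_not_pong [simp]: "base N \<notin> pong_set"
  by (simp add: base_def pong_set_def)

text \<open>\<open>reflect N\<close> brings every point outside \<open>pong_set\<close> to
  \<open>j = 0\<close>, a nonzero shift then makes \<open>j\<close> nonzero, and
  \<open>reflect N\<close> sends all points with \<open>j \<noteq> 0\<close> into
  \<open>pong_set\<close>.\<close>

lemma f_elt_pong: "z \<notin> pong_set \<Longrightarrow> k \<noteq> 0 \<Longrightarrow> f_elt N k z \<in> pong_set"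
proof -
  assume z: "z \<notin> pong_set" and k: "k \<noteq> 0"
  have "fst (reflect N z) = 0"
    using z by (cases z) (auto simp: pong_set_def)
  then have "fst (shift k (reflect N z)) \<noteq> 0"
    using k by (auto simp: shift_def split: prod.splits)
  then show ?thesis
    by (simp add: f_elt_def reflect_nz pong_set_def)
qed

lemma e_elt_pong:
  assumes "z \<in> pong_set" "small N k" "k \<noteq> 0"
  shows "e_elt N k z \<notin> pong_set" "e_elt N k z \<noteq> base N"
proof -
  obtain m where z: "z = (0, m, False)" using assms by (auto simp: pong_set_def)
  have b: "\<not> bit (k div 2) N" using assms small_div_2 by blast
  have e: "e_elt N k z = (k div 2, m, odd k)"
    using b by (auto simp: e_elt_def z shift_def flip_sign_def)
  have "k div 2 \<noteq> 0 \<or> odd k" using assms(3) by (cases "odd k") auto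
  then show "e_elt N k z \<notin> pong_set" by (auto simp: e pong_set_def)
  have "\<not> bit (k div 2) (Suc N)"
    using assms(2) by (auto simp: small_def simp flip: bit_Suc)
  then show "e_elt N k z \<noteq> base N"
    by (auto simp: e base_def bit_exp_iff simp del: power_Suc)
qed

lemma e_elt_base:
  assumes "small N k" "k \<noteq> 0"
  shows "e_elt N k (base N) \<notin> pong_set" "e_elt N k (base N) \<noteq> base N"
proof -
  have b: "\<not> bit (k div 2) N" using assms small_div_2 by blast
  have "\<not> bit (k div 2) (Suc N)"
    using assms(1) by (auto simp: small_def simp flip: bit_Suc)
  then have ne: "2 ^ Suc N XOR (k div 2) \<noteq> 0"
    by (metis bit_0_eq bit_exp_iff bit_xor_iff bot_apply bot_bool_def possible_bit_nat)
  have e: "e_elt N k (base N) = (2 ^ Suc N XOR (k div 2), 0, even k)"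
    using b by (auto simp: e_elt_def base_def shift_def flip_sign_def bit_xor_iff bit_exp_iff simp del: power_Suc)
  show "e_elt N k (base N) \<notin> pong_set" using ne by (auto simp: e pong_set_def)
  have "k div 2 \<noteq> 0 \<or> odd k" using assms(2) by (cases "odd k") auto
  moreover have "2 ^ Suc N XOR (k div 2) = 2 ^ Suc N \<Longrightarrow> k div 2 = 0"
    by (metis xor.assoc xor_self_eq xor.left_neutral)
  ultimately show "e_elt N k (base N) \<noteq> base N"
    unfolding e by (auto simp: base_def simp del: power_Suc)
qed

section \<open>The automorphism exchanging the two families, through reduced words\<close>

inductive swapped :: "nat \<Rightarrow> (point \<Rightarrow> point) \<Rightarrow> (point \<Rightarrow> point) \<Rightarrow> bool" for N where
  sw_one: "swapped N id id"
| sw_e: "swapped N c c' \<Longrightarrow> small N k \<Longrightarrow> swapped N (e_elt N k \<circ> c) (f_elt N k \<circ> c')"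
| sw_f: "swapped N c c' \<Longrightarrow> small N k \<Longrightarrow> swapped N (f_elt N k \<circ> c) (e_elt N k \<circ> c')"

text \<open>Nonempty reduced words: the factors alternate between the two families, and the Boolean
  tells whether the leftmost factor of the first map is an \<open>e_elt\<close>.\<close>

inductive alternating :: "nat \<Rightarrow> bool \<Rightarrow> (point \<Rightarrow> point) \<Rightarrow> (point \<Rightarrow> point) \<Rightarrow> bool" for N where
  alt_e1: "small N k \<Longrightarrow> k \<noteq> 0 \<Longrightarrow> alternating N True (e_elt N k) (f_elt N k)"
| alt_f1: "small N k \<Longrightarrow> k \<noteq> 0 \<Longrightarrow> alternating N False (f_elt N k) (e_elt N k)"
| alt_e: "alternating N False c c' \<Longrightarrow> small N k \<Longrightarrow> k \<noteq> 0 \<Longrightarrow>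
    alternating N True (e_elt N k \<circ> c) (f_elt N k \<circ> c')"
| alt_f: "alternating N True c c' \<Longrightarrow> small N k \<Longrightarrow> k \<noteq> 0 \<Longrightarrow>
    alternating N False (f_elt N k \<circ> c) (e_elt N k \<circ> c')"

text \<open>Ping-pong: the leftmost factor decides the side on which the image of
  \<open>base N\<close> lies. In either case the image differs from \<open>base N\<close>, so no
  nonempty reduced word is the identity.\<close>

lemma alternating_base:
  "alternating N t c c' \<Longrightarrow> c (base N) \<noteq> base N \<and> (c (base N) \<in> pong_set \<longleftrightarrow> \<not> t)"
proof (induction rule: alternating.induct)
  case (alt_f1 k)
  then show ?case using f_elt_pong[OF base_not_pong] base_not_pong by metis
next
  case (alt_f c c' k)
  then have "f_elt N k (c (base N)) \<in> pong_set" using f_elt_pong by simp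
  then show ?case using base_not_pong by (metis comp_apply)
qed (use e_elt_pong e_elt_base in auto)

text \<open>A nontrivial factor multiplied from the left either merges with a leading factor of its
  own family, perhaps cancelling it, or lengthens the word by one.\<close>

lemma alternating_e:
  assumes "c = id \<and> c' = id \<or> (\<exists>t. alternating N t c c')" "small N k"
  shows "e_elt N k \<circ> c = id \<and> f_elt N k \<circ> c' = id \<or>
    (\<exists>t. alternating N t (e_elt N k \<circ> c) (f_elt N k \<circ> c'))"
proof (cases "k = 0")
  case True
  with assms show ?thesis by simp
next
  case k: False
  consider "c = id" "c' = id" | "alternating N True c c'" | "alternating N False c c'"
    using assms(1) by (metis (full_types))
  then show ?thesis
  proof cases
    case 1
    then show ?thesis using alt_e1[OF assms(2) k] by auto
  next
    case 2
    then show ?thesis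
    proof cases
      case (alt_e1 l)
      then show ?thesis
        using assms(2) alternating.alt_e1[of N "k XOR l"] small_xor
        by (cases "k XOR l = 0") (auto simp: e_elt_mult f_elt_mult)
    next
      case (alt_e b b' l)
      have "e_elt N k \<circ> c = e_elt N (k XOR l) \<circ> b" "f_elt N k \<circ> c' = f_elt N (k XOR l) \<circ> b'"
        using alt_e assms(2) by (simp_all add: e_elt_mult f_elt_mult flip: comp_assoc)
      then show ?thesis
        using alt_e alternating.alt_e[OF alt_e(3), of "k XOR l"] small_xor[OF assms(2)]
        by (cases "k XOR l = 0") auto
    qed simp_all
  next
    case 3
    then show ?thesis using alt_e[OF _ assms(2) k] by blast
  qed
qed

lemma alternating_sym: "alternating N t c c' \<Longrightarrow> alternating N (\<not> t) c' c"
  by (induction rule: alternating.induct)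
     (simp_all only: not_True_eq_False not_False_eq_True alternating.intros)

lemma swapped_sym: "swapped N c c' \<Longrightarrow> swapped N c' c"
  by (induction rule: swapped.induct) (simp_all only: swapped.intros)

lemma swapped_alternating:
  "swapped N c c' \<Longrightarrow> c = id \<and> c' = id \<or> (\<exists>t. alternating N t c c')"
proof (induction rule: swapped.induct)
  case (sw_e c c' k)
  then show ?case by (intro alternating_e)
next
  case (sw_f c c' k)
  \<comment> \<open>The exchange symmetry reduces this case to the previous one.\<close>
  then have "c' = id \<and> c = id \<or> (\<exists>t. alternating N t c' c)"
    using alternating_sym by blast
  from alternating_e[OF this sw_f.hyps(2)] show ?case
    using alternating_sym by blast
qed simp

lemma swapped_id: "swapped N id c \<Longrightarrow> c = id"
  using swapped_alternating[of N id c] alternating_base by fastforce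

lemma swapped_mult: "swapped N a a' \<Longrightarrow> swapped N b b' \<Longrightarrow> swapped N (a \<circ> b) (a' \<circ> b')"
  by (induction rule: swapped.induct) (simp_all only: comp_assoc id_comp swapped.intros)

lemma e_elt_self: "small N k \<Longrightarrow> e_elt N k \<circ> e_elt N k = id"
  and f_elt_self: "f_elt N k \<circ> f_elt N k = id"
  by (simp_all add: e_elt_mult f_elt_mult)

lemma comp_cancel_middle: "x \<circ> y = id \<Longrightarrow> (b \<circ> x) \<circ> (y \<circ> c) = b \<circ> c"
  by (simp add: fun_eq_iff)

lemma swapped_inverse:
  "swapped N a a' \<Longrightarrow> \<exists>b b'. swapped N b b' \<and> b \<circ> a = id \<and> a \<circ> b = id \<and> b' \<circ> a' = id \<and> a' \<circ> b' = id"
proof (induction rule: swapped.induct)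
  case sw_one
  show ?case using swapped.sw_one by fastforce
next
  case (sw_e c c' k)
  then obtain b b' where b: "swapped N b b'" "b \<circ> c = id" "c \<circ> b = id" "b' \<circ> c' = id" "c' \<circ> b' = id"
    by blast
  have "swapped N (b \<circ> e_elt N k) (b' \<circ> f_elt N k)"
    using swapped_mult[OF b(1) swapped.sw_e[OF sw_one sw_e.hyps(2)]] by simp
  then show ?case
    using b e_elt_self[OF sw_e.hyps(2)] f_elt_self[of N k]
    by (intro exI[of _ "b \<circ> e_elt N k"] exI[of _ "b' \<circ> f_elt N k"])
       (simp add: comp_cancel_middle del: o_apply)
next
  case (sw_f c c' k)
  then obtain b b' where b: "swapped N b b'" "b \<circ> c = id" "c \<circ> b = id" "b' \<circ> c' = id" "c' \<circ> b' = id"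
    by blast
  have "swapped N (b \<circ> f_elt N k) (b' \<circ> e_elt N k)"
    using swapped_mult[OF b(1) swapped.sw_f[OF sw_one sw_f.hyps(2)]] by simp
  then show ?case
    using b e_elt_self[OF sw_f.hyps(2)] f_elt_self[of N k]
    by (intro exI[of _ "b \<circ> f_elt N k"] exI[of _ "b' \<circ> e_elt N k"])
       (simp add: comp_cancel_middle del: o_apply)
qed

text \<open>Words are seen only through the permutations they define; the exchange is well defined
  because its kernel is trivial by \<open>swapped_id\<close>.\<close>

lemma swapped_fun:
  assumes "swapped N a b" "swapped N a b'"
  shows "b = b'"
proof -
  obtain c c' where c: "swapped N c c'" "c \<circ> a = id" "c' \<circ> b = id" "b \<circ> c' = id"
    using swapped_inverse[OF assms(1)] by blast
  have "c' \<circ> b' = id"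
    using swapped_mult[OF c(1) assms(2)] swapped_id c(2) by simp
  then have "b \<circ> (c' \<circ> b') = b" by simp
  then show ?thesis using c(4) by (simp flip: comp_assoc)
qed

section \<open>Realising the automorphism by a permutation\<close>

definition coset_rep :: "nat \<Rightarrow> (point \<Rightarrow> point) \<Rightarrow> (point \<Rightarrow> point)" where
  "coset_rep N a = (SOME r. \<exists>c c'. swapped N c c' \<and> a = c \<circ> r)"

lemma coset_rep:
  obtains c c' where "swapped N c c'" "a = c \<circ> coset_rep N a"
proof -
  have "\<exists>c c'. swapped N c c' \<and> a = c \<circ> a"
    using sw_one by fastforce
  then have "\<exists>c c'. swapped N c c' \<and> a = c \<circ> coset_rep N a"
    unfolding coset_rep_def by (rule someI[of "\<lambda>r. \<exists>c c'. swapped N c c' \<and> a = c \<circ> r"])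
  then show ?thesis using that by blast
qed

text \<open>The predicate behind the choice depends on the coset of \<open>a\<close> only, hence so
  does the chosen representative.\<close>

lemma coset_rep_mult:
  assumes "swapped N c c'"
  shows "coset_rep N (c \<circ> a) = coset_rep N a"
proof -
  obtain b b' where b: "swapped N b b'" "b \<circ> c = id" "c \<circ> b = id"
    using swapped_inverse[OF assms] by blast
  have "(\<exists>d d'. swapped N d d' \<and> c \<circ> a = d \<circ> r) \<longleftrightarrow> (\<exists>d d'. swapped N d d' \<and> a = d \<circ> r)" for r
  proof safe
    fix d d' assume d: "swapped N d d'" "c \<circ> a = d \<circ> r"
    have "b \<circ> (c \<circ> a) = b \<circ> (d \<circ> r)" by (simp only: d(2))
    then have "a = (b \<circ> d) \<circ> r"
      by (simp only: comp_assoc[symmetric] b(2) id_comp)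
    then show "\<exists>d d'. swapped N d d' \<and> a = d \<circ> r"
      using swapped_mult[OF b(1) d(1)] by blast
  next
    fix d d' assume d: "swapped N d d'"
    show "\<exists>e e'. swapped N e e' \<and> c \<circ> (d \<circ> r) = e \<circ> r"
      using swapped_mult[OF assms d] comp_assoc[of c d r, symmetric] by blast
  qed
  then show ?thesis unfolding coset_rep_def by simp
qed

text \<open>Left multiplication on bijections is free, so \<open>c\<close> in
  \<open>a = c \<circ> coset_rep N a\<close> is unique and can be replaced by its partner
  \<open>c'\<close>. Maps that are not bijections stay fixed, which makes this an involution of the
  whole function type.\<close>

definition swap_coset :: "nat \<Rightarrow> (point \<Rightarrow> point) \<Rightarrow> (point \<Rightarrow> point)" where
  "swap_coset N a = (if bij a
     then (SOME c'. \<exists>c. swapped N c c' \<and> a = c \<circ> coset_rep N a) \<circ> coset_rep N a else a)"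

lemma swapped_bij: "swapped N c c' \<Longrightarrow> bij c"
  by (metis swapped_inverse o_bij)

lemma coset_rep_bij:
  assumes "bij a"
  shows "bij (coset_rep N a)"
proof -
  obtain d d' where d: "swapped N d d'" "a = d \<circ> coset_rep N a" by (rule coset_rep)
  obtain b b' where b: "swapped N b b'" "b \<circ> d = id" using swapped_inverse[OF d(1)] by blast
  have "b \<circ> a = b \<circ> (d \<circ> coset_rep N a)" by (simp only: d(2)[symmetric])
  then have "b \<circ> a = coset_rep N a" by (simp only: comp_assoc[symmetric] b(2) id_comp)
  then show ?thesis using bij_comp[OF assms swapped_bij[OF b(1)]] by simp
qed

lemma swap_coset:
  assumes "bij a" "swapped N c c'" "a = c \<circ> coset_rep N a"
  shows "swap_coset N a = c' \<circ> coset_rep N a"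
proof -
  let ?r = "coset_rep N a"
  have r: "bij ?r" by (rule coset_rep_bij[OF assms(1)])
  have "(SOME c'. \<exists>c. swapped N c c' \<and> a = c \<circ> ?r) = c'"
  proof (rule some_equality)
    show "\<exists>c. swapped N c c' \<and> a = c \<circ> ?r" using assms by blast
    fix d' assume "\<exists>d. swapped N d d' \<and> a = d \<circ> ?r"
    then obtain d where d: "swapped N d d'" "a = d \<circ> ?r" by blast
    then have eq: "d \<circ> ?r = c \<circ> ?r" using assms(3) by simp
    have "d = c"
    proof
      fix z
      obtain y where "z = ?r y" using r by (metis bij_pointE)
      then show "d z = c z" using fun_cong[OF eq, of y] by simp
    qed
    then show "d' = c'" using swapped_fun d(1) assms(2) by blast
  qed
  then show ?thesis using assms(1) by (simp add: swap_coset_def)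
qed

lemma swap_coset_bij:
  assumes "bij a"
  shows "bij (swap_coset N a)" "coset_rep N (swap_coset N a) = coset_rep N a"
    "swap_coset N (swap_coset N a) = a"
    "swapped N c c' \<Longrightarrow> swap_coset N (c \<circ> a) = c' \<circ> swap_coset N a"
proof -
  let ?r = "coset_rep N a"
  obtain d d' where d: "swapped N d d'" "a = d \<circ> ?r" by (rule coset_rep)
  have r: "bij ?r" by (rule coset_rep_bij[OF assms])
  have eq: "swap_coset N a = d' \<circ> ?r" by (rule swap_coset[OF assms d])
  show bij: "bij (swap_coset N a)"
    unfolding eq using swapped_bij[OF swapped_sym[OF d(1)]] r by (intro bij_comp)
  have "coset_rep N ?r = ?r"
    using coset_rep_mult[OF d(1), of ?r] d(2) by simp
  then show rep: "coset_rep N (swap_coset N a) = ?r"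
    unfolding eq using coset_rep_mult[OF swapped_sym[OF d(1)], of ?r] by simp
  show "swap_coset N (swap_coset N a) = a"
    using swap_coset[OF bij swapped_sym[OF d(1)]] rep eq d(2) by simp
  show "swap_coset N (c \<circ> a) = c' \<circ> swap_coset N a" if c: "swapped N c c'"
  proof -
    have "swap_coset N (c \<circ> a) = (c' \<circ> d') \<circ> coset_rep N (c \<circ> a)"
    proof (rule swap_coset)
      show "bij (c \<circ> a)" using assms swapped_bij[OF c] by (intro bij_comp)
      show "swapped N (c \<circ> d) (c' \<circ> d')" by (rule swapped_mult[OF c d(1)])
      show "c \<circ> a = c \<circ> d \<circ> coset_rep N (c \<circ> a)"
        unfolding coset_rep_mult[OF c] using d(2) by (simp add: comp_assoc)
    qed
    then show ?thesis by (simp add: eq coset_rep_mult[OF c] comp_assoc)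
  qed
qed

definition left_mult :: "(point \<Rightarrow> point) \<Rightarrow> (point \<Rightarrow> point) \<Rightarrow> (point \<Rightarrow> point)" where
  "left_mult g = (\<lambda>a. if bij a then g \<circ> a else a)"

lemma left_mult_comp: "bij h \<Longrightarrow> left_mult g \<circ> left_mult h = left_mult (g \<circ> h)"
  by (auto simp: left_mult_def fun_eq_iff bij_comp)

lemma left_mult_id [simp]: "left_mult id = id"
  by (auto simp: left_mult_def)

lemma left_mult_inj: "left_mult g = left_mult h \<Longrightarrow> g = h"
  by (metis bij_id comp_id left_mult_def)

lemma swap_coset_swap_coset: "swap_coset N \<circ> swap_coset N = id"
proof
  show "(swap_coset N \<circ> swap_coset N) a = id a" for a
    using swap_coset_bij(3)[of a N] by (cases "bij a") (auto simp: swap_coset_def)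
qed

lemma swap_coset_conj:
  assumes "swapped N c c'"
  shows "swap_coset N \<circ> left_mult c \<circ> swap_coset N = left_mult c'"
proof
  fix a
  show "(swap_coset N \<circ> left_mult c \<circ> swap_coset N) a = left_mult c' a"
  proof (cases "bij a")
    case True
    then show ?thesis
      using swap_coset_bij[OF True, of N] swap_coset_bij(4)[OF swap_coset_bij(1)[OF True] assms]
      by (simp add: left_mult_def)
  qed (simp add: left_mult_def swap_coset_def)
qed


section \<open>The permutations and their relations\<close>

definition S_perm where "S_perm N = left_mult (reflect N)"
definition x_perm where "x_perm N = left_mult (flip_sign N)"
text \<open>As products of the same two involutions in the two orders, \<open>D_perm N\<close> and
  \<open>d_perm N\<close> are mutually inverse and conjugate under \<open>S_perm N\<close>.\<close>

definition D_perm where "D_perm N = S_perm N \<circ> swap_coset N"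
definition d_perm where "d_perm N = swap_coset N \<circ> S_perm N"

lemma bij_reflect [simp]: "bij (reflect N)"
  by (rule o_bij[of "reflect N"]) (auto simp: fun_eq_iff)

lemma bij_flip_sign [simp]: "bij (flip_sign N)"
  by (rule o_bij[of "flip_sign N"]) (auto simp: fun_eq_iff)

lemma bij_shift [simp]: "bij (shift k)"
  by (rule o_bij[of "shift k"]) (auto simp: fun_eq_iff)

lemma S_perm_S_perm: "S_perm N \<circ> S_perm N = id"
proof -
  have "reflect N \<circ> reflect N = id" by (auto simp: fun_eq_iff)
  then show ?thesis by (simp add: S_perm_def left_mult_comp del: o_apply)
qed

lemma x_perm_x_perm: "x_perm N \<circ> x_perm N = id"
proof -
  have "flip_sign N \<circ> flip_sign N = id" by (auto simp: fun_eq_iff)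
  then show ?thesis by (simp add: x_perm_def left_mult_comp del: o_apply)
qed

lemma braid_perm: "S_perm N \<circ> x_perm N \<circ> S_perm N = x_perm N \<circ> S_perm N \<circ> x_perm N"
proof -
  have "reflect N \<circ> flip_sign N \<circ> reflect N = flip_sign N \<circ> reflect N \<circ> flip_sign N"
    using braid by (auto simp: fun_eq_iff)
  then show ?thesis
    by (simp add: S_perm_def x_perm_def left_mult_comp del: o_apply)
qed

lemma D_perm_d_perm: "D_perm N \<circ> d_perm N = id" "d_perm N \<circ> D_perm N = id"
  unfolding D_perm_def d_perm_def
  by (simp_all only: comp_cancel_middle[OF swap_coset_swap_coset] comp_cancel_middle[OF S_perm_S_perm]
      S_perm_S_perm swap_coset_swap_coset)

lemma S_perm_D_perm: "S_perm N \<circ> D_perm N = d_perm N \<circ> S_perm N"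
proof -
  have "S_perm N \<circ> D_perm N = swap_coset N"
    by (simp only: D_perm_def comp_assoc[symmetric] S_perm_S_perm id_comp)
  moreover have "d_perm N \<circ> S_perm N = swap_coset N"
    by (simp only: d_perm_def comp_assoc S_perm_S_perm comp_id)
  ultimately show ?thesis by simp
qed

definition x_elt :: "nat \<Rightarrow> nat \<Rightarrow> point \<Rightarrow> point" where
  "x_elt N i = (if i = 0 then flip_sign N else shift (2 ^ (i - 1)))"

lemma x_elt_e_elt: "x_elt N i = e_elt N (2 ^ i)"
proof (cases i)
  case 0
  then show ?thesis by (auto simp: x_elt_def e_elt_def shift_def fun_eq_iff)
next
  case (Suc j)
  then show ?thesis by (simp add: x_elt_def e_elt_def)
qed

text \<open>In one conjugation by \<open>D_perm N\<close>, \<open>swap_coset N\<close> turns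
  \<open>e_elt N (2 ^ i)\<close> into \<open>f_elt N (2 ^ i)\<close>, and \<open>S_perm N\<close>
  turns this into \<open>shift (2 ^ i)\<close>, the next \<open>x_elt\<close>. The exchange is
  available for \<open>i \<le> N\<close>, so the last index reached is \<open>Suc N\<close>.\<close>

lemma conj_x_perm: "i \<le> Suc N \<Longrightarrow> (D_perm N ^^ i) \<circ> x_perm N \<circ> (d_perm N ^^ i) = left_mult (x_elt N i)"
proof (induction i)
  case 0
  then show ?case by (simp add: x_elt_def x_perm_def)
next
  case (Suc i)
  have small: "small N (2 ^ i)" using Suc.prems by (auto simp: small_def bit_exp_iff)
  have "(D_perm N ^^ Suc i) \<circ> x_perm N \<circ> (d_perm N ^^ Suc i) =
      D_perm N \<circ> ((D_perm N ^^ i) \<circ> x_perm N \<circ> (d_perm N ^^ i)) \<circ> d_perm N"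
    by (simp only: funpow.simps(2)[of _ "D_perm N"] funpow_Suc_right[of _ "d_perm N"] comp_assoc)
  also have "\<dots> = S_perm N \<circ> (swap_coset N \<circ> left_mult (e_elt N (2 ^ i)) \<circ> swap_coset N) \<circ> S_perm N"
    using Suc by (simp add: D_perm_def d_perm_def x_elt_e_elt comp_assoc del: o_apply)
  also have "\<dots> = left_mult (reflect N) \<circ> left_mult (f_elt N (2 ^ i)) \<circ> left_mult (reflect N)"
    using swap_coset_conj[OF sw_e[OF sw_one small]] by (simp add: S_perm_def del: o_apply)
  also have "\<dots> = left_mult (reflect N \<circ> f_elt N (2 ^ i) \<circ> reflect N)"
    by (simp add: left_mult_comp f_elt_def bij_comp comp_assoc del: o_apply)
  also have "reflect N \<circ> f_elt N (2 ^ i) \<circ> reflect N = x_elt N (Suc i)"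
    by (auto simp: f_elt_def x_elt_def fun_eq_iff)
  finally show ?case .
qed

text \<open>For \<open>0 < i \<le> N\<close> the conjugate changes only digit \<open>i - 1\<close>
  of \<open>j\<close>, which \<open>flip_sign N\<close> does not inspect.\<close>

lemma x_perm_commute:
  assumes "i \<le> N"
  shows "x_perm N \<circ> ((D_perm N ^^ i) \<circ> x_perm N \<circ> (d_perm N ^^ i)) =
    (D_perm N ^^ i) \<circ> x_perm N \<circ> (d_perm N ^^ i) \<circ> x_perm N"
proof -
  have "flip_sign N \<circ> x_elt N i = x_elt N i \<circ> flip_sign N"
    using assms by (auto simp: x_elt_def fun_eq_iff shift_flip_sign bit_exp_iff)
  moreover have "bij (x_elt N i)" by (simp add: x_elt_def)
  ultimately show ?thesis
    using assms conj_x_perm[of i N] by (simp add: x_perm_def left_mult_comp del: o_apply)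
qed

text \<open>The conjugate now changes digit \<open>N\<close>, the one on which
  \<open>flip_sign N\<close> depends; at \<open>(0, 0, True)\<close> the two orders give different
  signs.\<close>

lemma x_perm_not_commute:
  "x_perm N \<circ> ((D_perm N ^^ Suc N) \<circ> x_perm N \<circ> (d_perm N ^^ Suc N)) \<noteq>
    (D_perm N ^^ Suc N) \<circ> x_perm N \<circ> (d_perm N ^^ Suc N) \<circ> x_perm N"
proof
  assume "x_perm N \<circ> ((D_perm N ^^ Suc N) \<circ> x_perm N \<circ> (d_perm N ^^ Suc N)) =
    (D_perm N ^^ Suc N) \<circ> x_perm N \<circ> (d_perm N ^^ Suc N) \<circ> x_perm N"
  then have "left_mult (flip_sign N \<circ> shift (2 ^ N)) = left_mult (shift (2 ^ N) \<circ> flip_sign N)"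
    using conj_x_perm[of "Suc N" N] by (simp add: x_elt_def x_perm_def left_mult_comp del: o_apply funpow.simps)
  then have "flip_sign N (shift (2 ^ N) (0, 0, True)) = shift (2 ^ N) (flip_sign N (0, 0, True))"
    using left_mult_inj by (metis comp_apply)
  then show False by (simp add: shift_def flip_sign_def bit_exp_iff)
qed

lemma bij_perms: "bij (S_perm N)" "bij (x_perm N)" "bij (D_perm N)" "bij (d_perm N)"
  using o_bij[OF S_perm_S_perm S_perm_S_perm] o_bij[OF x_perm_x_perm x_perm_x_perm]
    o_bij[OF D_perm_d_perm(2,1)] o_bij[OF D_perm_d_perm] by auto

section \<open>Presentation of the group of Laurent polynomial matrices\<close>

type_synonym vec2 = "bit poly \<times> bit poly"

abbreviation (input) tvar :: "bit poly" where "tvar \<equiv> [:0, 1:]"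

definition e12 :: "bit poly \<Rightarrow> vec2 \<Rightarrow> vec2" where
  "e12 f = (\<lambda>(a, b). (a + f * b, b))"

definition diag_t1 :: "vec2 \<Rightarrow> vec2" where
  "diag_t1 = (\<lambda>(a, b). (tvar * a, b))"

definition diag_1t :: "vec2 \<Rightarrow> vec2" where
  "diag_1t = (\<lambda>(a, b). (a, tvar * b))"

definition scale :: "bit poly \<Rightarrow> vec2 \<Rightarrow> vec2" where
  "scale p = (\<lambda>(a, b). (p * a, p * b))"

lemmas mat_defs = e12_def diag_t1_def diag_1t_def scale_def

lemma bit_poly_add_self [simp]: "(f :: bit poly) + f = 0" "f + (f + g) = g"
proof -
  show 1: "f + f = 0" for f :: "bit poly"
    by (induction f) auto
  show "f + (f + g) = g"
    by (simp add: 1 flip: add.assoc)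
qed

lemma bit_poly_degree_0: "degree f = 0 \<Longrightarrow> f = 0 \<or> f = (1 :: bit poly)"
proof -
  assume "degree f = 0"
  then obtain a where "f = [:a:]" by (rule degree_eq_zeroE)
  then show ?thesis by (cases a) (auto simp: one_pCons)
qed

lemma bit_poly_unit:
  fixes p q :: "bit poly"
  assumes "p * q = 1"
  shows "p = 1"
proof -
  have "p \<noteq> 0" "q \<noteq> 0" using assms by auto
  then have "degree p = 0"
    using arg_cong[OF assms, of degree] by (simp add: degree_mult_eq)
  then show ?thesis
    using bit_poly_degree_0 \<open>p \<noteq> 0\<close> by blast
qed

text \<open>The full system of relations, stated in a monoid because germs of self-maps need not be
  invertible; \<open>SS\<close>, \<open>xx\<close>, \<open>Dd\<close> and \<open>dD\<close> make the
  four elements themselves invertible.\<close>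

locale gl2_relations =
  fixes S x D d :: "'h :: monoid_mult"
  assumes SS: "S * S = 1" and xx: "x * x = 1" and SxS: "S * x * S = x * S * x"
    and Dd: "D * d = 1" and dD: "d * D = 1" and SD: "S * D = d * S"
    and commute: "x * (D ^ i * x * d ^ i) = D ^ i * x * d ^ i * x"
begin

text \<open>
  Matrices matter up to powers of \<open>t\<close> only, so \<open>d = D\<^sup>-\<^sup>1\<close> is matched with \<open>diag(1, t)\<close> and all
  matrices stay polynomial.
\<close>

inductive_set pairs :: "((vec2 \<Rightarrow> vec2) \<times> 'h) set" where
  pairs_one: "(id, 1) \<in> pairs"
| pairs_S: "(M, h) \<in> pairs \<Longrightarrow> (prod.swap \<circ> M, S * h) \<in> pairs"
| pairs_x: "(M, h) \<in> pairs \<Longrightarrow> (e12 1 \<circ> M, x * h) \<in> pairs"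
| pairs_D: "(M, h) \<in> pairs \<Longrightarrow> (diag_t1 \<circ> M, D * h) \<in> pairs"
| pairs_d: "(M, h) \<in> pairs \<Longrightarrow> (diag_1t \<circ> M, d * h) \<in> pairs"

lemma SS': "S * (S * h) = h"
  and SxS': "S * (x * (S * h)) = x * (S * (x * h))"
  and Dd': "D * (d * h) = h" and dD': "d * (D * h) = h"
  and SD': "S * (D * h) = d * (S * h)"
  using arg_cong[OF SxS, of "\<lambda>y. y * h"] arg_cong[OF SD, of "\<lambda>y. y * h"]
  by (simp_all add: SS xx Dd dD mult.assoc) (simp_all add: SS xx Dd dD flip: mult.assoc)

lemma Sd': "S * (d * h) = D * (S * h)"
  using SD'[of "S * h"] by (metis SS')

section \<open>Unipotent elements indexed by polynomials\<close>

definition xpow :: "bit \<Rightarrow> 'h" where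
  "xpow a = (if a = 0 then 1 else x)"

lemma xpow_simps [simp]: "xpow 0 = 1" "xpow 1 = x"
  by (auto simp: xpow_def)

text \<open>The companion of the elementary matrix \<open>e12 f\<close>, computed by Horner's rule:
  conjugation by \<open>D\<close> corresponds to multiplying the entry by \<open>t\<close>.\<close>

definition u :: "bit poly \<Rightarrow> 'h" where
  "u f = fold_coeffs (\<lambda>a h. xpow a * (D * h * d)) f 1"

lemma u_0 [simp]: "u 0 = 1"
  by (simp add: u_def)

lemma u_pCons: "u (pCons a f) = xpow a * (D * u f * d)"
  by (cases "a = 0 \<and> f = 0")
     (auto simp: u_def Dd xpow_def)

lemma u_1 [simp]: "u 1 = x"
  by (simp add: one_pCons u_pCons Dd)

lemma u_t: "u (tvar * f) = D * u f * d"
  by (simp add: u_pCons)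

lemma commute_mult: "y * a = a * y \<Longrightarrow> y * b = b * y \<Longrightarrow> y * (a * b) = a * b * y"
  for a :: 'h
proof -
  assume a: "y * a = a * y" and b: "y * b = b * y"
  have "y * (a * b) = a * y * b"
    by (simp only: a flip: mult.assoc)
  also have "\<dots> = a * b * y"
    by (simp only: mult.assoc b)
  finally show ?thesis .
qed

lemma dpow_Dpow: "d ^ i * D ^ i = 1" "D ^ i * d ^ i = 1"
proof (induction i)
  case (Suc i)
  { case 1
    have "d ^ Suc i * D ^ Suc i = d ^ i * (d * D) * D ^ i"
      by (simp only: power_Suc2[of d] power_Suc[of D] mult.assoc)
    with Suc show ?case by (simp add: dD) }
  { case 2
    have "D ^ Suc i * d ^ Suc i = D ^ i * (D * d) * d ^ i"
      by (simp only: power_Suc2[of D] power_Suc[of d] mult.assoc)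
    with Suc show ?case by (simp add: Dd) }
qed auto

text \<open>The conjugating power is kept general for the induction: splitting off the constant
  coefficient replaces \<open>i\<close> by \<open>i + 1\<close> for the remaining ones.\<close>

lemma x_commute_u_conj: "x * (D ^ i * u f * d ^ i) = D ^ i * u f * d ^ i * x"
proof (induction f arbitrary: i)
  case 0
  then show ?case by (simp add: dpow_Dpow)
next
  case (pCons a f)
  have "D ^ i * u (pCons a f) * d ^ i = D ^ i * xpow a * (d ^ i * D ^ i) * (D * u f * d) * d ^ i"
    by (simp add: u_pCons mult.assoc dpow_Dpow)
  also have "\<dots> = (D ^ i * xpow a * d ^ i) * (D ^ Suc i * u f * d ^ Suc i)"
    by (simp only: mult.assoc power_Suc2[of D] power_Suc[of d])
  finally have *: "D ^ i * u (pCons a f) * d ^ i = (D ^ i * xpow a * d ^ i) * (D ^ Suc i * u f * d ^ Suc i)" .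
  have "x * (D ^ i * xpow a * d ^ i) = D ^ i * xpow a * d ^ i * x"
    using commute[of i] by (cases "a = 0") (auto simp: xpow_def dpow_Dpow)
  then show ?case
    unfolding * using pCons.IH[of "Suc i"] by (rule commute_mult)
qed

text \<open>The constant coefficient of \<open>g\<close> passes the conjugate of \<open>u f\<close>
  by the case \<open>i = 1\<close> of \<open>x_commute_u_conj\<close>; the remaining coefficients
  are handled by induction.\<close>

lemma u_add: "u (f + g) = u f * u g"
proof (induction f arbitrary: g)
  case (pCons a f)
  obtain b g' where g: "g = pCons b g'" by (cases g)
  have "xpow (a + b) = xpow a * xpow b"
    by (cases a; cases b) (auto simp: xx)
  then have "u (pCons a f + g) = xpow a * (xpow b * (D * u f * d)) * (D * u g' * d)"
    unfolding g by (simp add: u_pCons pCons.IH mult.assoc dD')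
  also have "\<dots> = u (pCons a f) * u g"
  proof -
    have "xpow b * (D * u f * d) = D * u f * d * xpow b"
      using x_commute_u_conj[of 1 f] by (cases b) auto
    then show ?thesis
      by (simp only: g u_pCons mult.assoc)
  qed
  finally show ?case .
qed simp

lemma Du: "D * u f = u (tvar * f) * D"
  by (simp only: u_t mult.assoc dD mult_1_right)


lemma Du': "D * (u f * h) = u (tvar * f) * (D * h)"
  using arg_cong[OF Du[of f], of "\<lambda>y. y * h"] by (simp only: mult.assoc)

lemma e12_0 [simp]: "e12 0 = id"
  by (auto simp: mat_defs)

lemma e12_add: "e12 (f + g) = e12 f \<circ> e12 g"
  by (auto simp: mat_defs algebra_simps fun_eq_iff)

lemma swap_swap [simp]: "prod.swap \<circ> prod.swap = id" "prod.swap \<circ> (prod.swap \<circ> M) = M"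
  by (auto simp: fun_eq_iff)

text \<open>The braid relation as a rewriting rule: an inner factor \<open>u 1\<close> between two
  \<open>S\<close> disappears, one \<open>S\<close> is lost, and the next factor changes by 1.
  \<open>swap_e12_1\<close> is the counterpart for matrices.\<close>

lemma SuSu_1: "S * (u 1 * (S * (u f * h))) = u 1 * (S * (u (1 + f) * h))"
  by (simp add: SxS' u_add mult.assoc)

lemma swap_e12_1: "prod.swap \<circ> (e12 1 \<circ> (prod.swap \<circ> (e12 f \<circ> M))) = e12 1 \<circ> (prod.swap \<circ> (e12 (1 + f) \<circ> M))"
  by (auto simp: e12_def fun_eq_iff algebra_simps split: prod.splits)

section \<open>Normal form for matrices generated by the swap and the elementary matrices\<close>

inductive_set A_pairs :: "((vec2 \<Rightarrow> vec2) \<times> 'h) set" where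
  A_one: "(id, 1) \<in> A_pairs"
| A_S: "(M, h) \<in> A_pairs \<Longrightarrow> (prod.swap \<circ> M, S * h) \<in> A_pairs"
| A_u: "(M, h) \<in> A_pairs \<Longrightarrow> (e12 f \<circ> M, u f * h) \<in> A_pairs"

lemma A_mult: "(M, h) \<in> A_pairs \<Longrightarrow> (N, k) \<in> A_pairs \<Longrightarrow> (M \<circ> N, h * k) \<in> A_pairs"
  by (induction rule: A_pairs.induct) (auto simp: comp_assoc mult.assoc intro: A_pairs.intros)

lemma A_bij_linear:
  "(M, h) \<in> A_pairs \<Longrightarrow> bij M \<and> (\<forall>p v. M (scale p v) = scale p (M v))"
proof (induction rule: A_pairs.induct)
  case (A_S M h)
  then have "bij (\<lambda>v. prod.swap (M v))" using bij_comp[of M prod.swap] by (simp add: o_def)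
  moreover have "prod.swap (scale p v) = scale p (prod.swap v)" for p v
    by (cases v) (simp add: scale_def)
  ultimately show ?case using A_S by simp
next
  case (A_u M h f)
  have "e12 f \<circ> e12 f = id"
    by (simp flip: e12_add)
  then have "bij (e12 f)" by (metis o_bij)
  with A_u have "bij (\<lambda>v. e12 f (M v))" using bij_comp[of M "e12 f"] by (simp add: o_def)
  moreover have "e12 f (scale p v) = scale p (e12 f v)" for p v
    by (cases v) (simp add: mat_defs algebra_simps)
  ultimately show ?case using A_u by simp
qed (simp flip: id_def)

text \<open>
  Reduced words in \<open>S\<close> and the \<open>u f\<close>: with non-constant inner factors, degrees grow along the first column.
\<close>

inductive_set T_pairs :: "((vec2 \<Rightarrow> vec2) \<times> 'h) set" where
  T_last: "(prod.swap \<circ> e12 f, S * u f) \<in> T_pairs"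
| T_step: "(M, h) \<in> T_pairs \<Longrightarrow> degree f > 0 \<Longrightarrow> (prod.swap \<circ> (e12 f \<circ> M), S * (u f * h)) \<in> T_pairs"

lemma T_column:
  "(M, h) \<in> T_pairs \<Longrightarrow> snd (M (1, 0)) \<noteq> 0 \<and>
     (fst (M (1, 0)) = 0 \<or> degree (fst (M (1, 0))) < degree (snd (M (1, 0))))"
proof (induction rule: T_pairs.induct)
  case (T_step M h f)
  obtain a b where ab: "M (1, 0) = (a, b)" by fastforce
  have f: "f \<noteq> 0" using T_step.hyps by auto
  have b: "b \<noteq> 0" "a = 0 \<or> degree a < degree b" using T_step.IH ab by auto
  then have "degree (f * b) = degree f + degree b"
    using f by (simp add: degree_mult_eq)
  moreover have "degree (a + f * b) = degree (f * b)"
    using b T_step.hyps calculation by (cases "a = 0") (simp_all add: degree_add_eq_right)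
  ultimately have "degree b < degree (a + f * b)"
    using T_step.hyps by simp
  then show ?case by (auto simp: ab e12_def)
qed (simp add: e12_def)

text \<open>Left multiplication by \<open>S\<close> puts the leading factor \<open>u f\<close>
  inside the word. If \<open>f\<close> is not constant, the word stays reduced; if
  \<open>f = 0\<close>, two factors \<open>S\<close> cancel; the only other constant is 1, where the
  braid relation applies.\<close>

lemma A_normal_form:
  "(M, h) \<in> A_pairs \<Longrightarrow>
    (\<exists>f. M = e12 f \<and> h = u f) \<or> (\<exists>f N k. (N, k) \<in> T_pairs \<and> M = e12 f \<circ> N \<and> h = u f * k)"
proof (induction rule: A_pairs.induct)
  case A_one
  have "id = e12 0 \<and> 1 = u 0" by simp
  then show ?case by blast
next
  case (A_S M h)
  then consider f where "M = e12 f" "h = u f"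
    | f N k where "(N, k) \<in> T_pairs" "M = e12 f \<circ> N" "h = u f * k" by blast
  then show ?case
  proof cases
    case 1
    then have "(prod.swap \<circ> M, S * h) \<in> T_pairs" "prod.swap \<circ> M = e12 0 \<circ> (prod.swap \<circ> M)"
      "S * h = u 0 * (S * h)"
      by (auto intro: T_last)
    then show ?thesis by blast
  next
    case 2
    consider "degree f > 0" | "f = 0" | "f = 1"
      using bit_poly_degree_0 by blast
    then show ?thesis
    proof cases
      case 1
      with 2 have "(prod.swap \<circ> M, S * h) \<in> T_pairs" "prod.swap \<circ> M = e12 0 \<circ> (prod.swap \<circ> M)"
        "S * h = u 0 * (S * h)"
        by (auto intro: T_step)
      then show ?thesis by blast
    next
      case f: 2
      from 2(1) show ?thesis
      proof cases
        case (T_last f')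
        then have "prod.swap \<circ> M = e12 f'" "S * h = u f'"
          by (simp_all add: 2 f SS')
        then show ?thesis by blast
      next
        case (T_step N' k' f')
        then have "prod.swap \<circ> M = e12 f' \<circ> N'" "S * h = u f' * k'"
          by (simp_all add: 2 f SS')
        with T_step show ?thesis by blast
      qed
    next
      case f: 3
      from 2(1) show ?thesis
      proof cases
        case (T_last f')
        have "prod.swap \<circ> M = e12 1 \<circ> (prod.swap \<circ> e12 (1 + f'))"
          using swap_e12_1[of f' id] by (simp add: 2 f T_last)
        moreover have "S * h = u 1 * (S * u (1 + f'))"
          using SuSu_1[of f' 1] by (simp only: 2 f T_last mult_1_right)
        ultimately show ?thesis using T_pairs.T_last by blast
      next
        case (T_step N' k' f')
        have "degree (1 + f') > 0"
          using T_step by (metis degree_1 degree_add_eq_right)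
        then have "(prod.swap \<circ> (e12 (1 + f') \<circ> N'), S * (u (1 + f') * k')) \<in> T_pairs"
          using T_step by (intro T_pairs.T_step)
        moreover have "prod.swap \<circ> M = e12 1 \<circ> (prod.swap \<circ> (e12 (1 + f') \<circ> N'))"
          using swap_e12_1[of f' N'] by (simp only: 2 f T_step)
        moreover have "S * h = u 1 * (S * (u (1 + f') * k'))"
          using SuSu_1[of f' k'] by (simp only: 2 f T_step)
        ultimately show ?thesis by blast
      qed
    qed
  qed
next
  case (A_u M h f)
  then consider g where "M = e12 g" "h = u g"
    | g N k where "(N, k) \<in> T_pairs" "M = e12 g \<circ> N" "h = u g * k" by blast
  then show ?case
  proof cases
    case 1
    then have "e12 f \<circ> M = e12 (f + g)" "u f * h = u (f + g)"
      by (simp_all add: e12_add u_add)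
    then show ?thesis by blast
  next
    case 2
    then have "e12 f \<circ> M = e12 (f + g) \<circ> N" "u f * h = u (f + g) * k"
      by (simp_all add: e12_add u_add comp_assoc mult.assoc)
    with 2 show ?thesis by blast
  qed
qed

text \<open>The first column of a matrix from \<open>T_pairs\<close> has nonzero second entry, which
  excludes the second normal form; in the first, \<open>f\<close> is read off from the image of
  \<open>(0, 1)\<close>.\<close>

lemma A_id: "(id, h) \<in> A_pairs \<Longrightarrow> h = 1"
proof (drule A_normal_form, elim disjE exE conjE)
  fix f assume "id = e12 f" and h: "h = u f"
  then have "e12 f (0, 1) = (0, 1)" by (metis id_apply)
  then show "h = 1" by (simp add: e12_def h)
next
  fix f N k assume N: "(N, k) \<in> T_pairs" and "id = e12 f \<circ> N"
  then have "e12 f (N (1, 0)) = (1, 0)" by (metis comp_apply id_apply)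
  then show "h = 1"
    using T_column[OF N] by (auto simp: e12_def split: prod.splits)
qed


section \<open>The subgroup of matrices upper triangular modulo t, and its cosets\<close>

inductive_set C_pairs :: "((vec2 \<Rightarrow> vec2) \<times> 'h) set" where
  C_one: "(id, 1) \<in> C_pairs"
| C_u: "(M, h) \<in> C_pairs \<Longrightarrow> (e12 f \<circ> M, u f * h) \<in> C_pairs"
| C_l: "(M, h) \<in> C_pairs \<Longrightarrow>
    (prod.swap \<circ> (e12 (tvar * f) \<circ> (prod.swap \<circ> M)), S * (u (tvar * f) * (S * h))) \<in> C_pairs"

lemma C_mult: "(M, h) \<in> C_pairs \<Longrightarrow> (N, k) \<in> C_pairs \<Longrightarrow> (M \<circ> N, h * k) \<in> C_pairs"
  by (induction rule: C_pairs.induct)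
     (simp_all only: comp_assoc mult.assoc id_comp mult_1 C_pairs.intros)

lemma C_subset_A: "(M, h) \<in> C_pairs \<Longrightarrow> (M, h) \<in> A_pairs"
  by (induction rule: C_pairs.induct) (simp_all only: A_pairs.intros)

text \<open>
  The matrices that are upper triangular modulo \<open>t\<close> form a subgroup of index three, which is normalised by
  \<open>S D\<close>. This yields a normal form \<open>a k a'\<close> up to powers of \<open>t\<close>, with \<open>a\<close>, \<open>a'\<close> polynomial and \<open>k\<close> upper
  triangular.
\<close>

definition A_cosets :: "((vec2 \<Rightarrow> vec2) \<times> 'h) set" where
  "A_cosets = C_pairs \<union> {(N \<circ> (prod.swap \<circ> e12 [:a:]), k * (S * u [:a:])) | N k a. (N, k) \<in> C_pairs}"

text \<open>Right multiplication by \<open>S\<close> exchanges the cosets of 1 and \<open>S\<close>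
  and, by the braid relation, fixes that of \<open>S * x\<close>.\<close>

lemma A_cosets_S:
  assumes "(M, h) \<in> A_cosets"
  shows "(M \<circ> prod.swap, h * S) \<in> A_cosets"
proof -
  consider "(M, h) \<in> C_pairs"
    | N k a where "(N, k) \<in> C_pairs" "M = N \<circ> (prod.swap \<circ> e12 [:a:])" "h = k * (S * u [:a:])"
    using assms by (auto simp: A_cosets_def)
  then show ?thesis
  proof cases
    case 1
    moreover have "M \<circ> prod.swap = M \<circ> (prod.swap \<circ> e12 [:0:])" "h * S = h * (S * u [:0:])"
      by simp_all
    ultimately show ?thesis unfolding A_cosets_def by blast
  next
    case 2
    show ?thesis
    proof (cases a)
      case zero
      with 2 show ?thesis by (simp add: A_cosets_def comp_assoc mult.assoc SS)
    next
      case one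
      then have a: "[:a:] = 1" by (simp add: one_pCons)
      have "(N \<circ> e12 1, k * u 1) \<in> C_pairs"
        using 2(1) C_mult[OF 2(1) C_u[OF C_one, of 1]] by simp
      moreover have "M \<circ> prod.swap = N \<circ> e12 1 \<circ> (prod.swap \<circ> e12 [:a:])"
        using swap_e12_1[of 0 id] by (simp add: 2 a comp_assoc)
      moreover have "h * S = k * u 1 * (S * u [:a:])"
        using SxS by (simp add: 2 a mult.assoc)
      ultimately show ?thesis unfolding A_cosets_def by blast
    qed
  qed
qed

text \<open>On the cosets of \<open>S\<close> and \<open>S * x\<close>, the constant coefficient of
  \<open>f\<close> acts on the representative; the rest is divisible by \<open>t\<close> and passes
  \<open>S\<close> as a lower triangular element of the subgroup.\<close>

lemma A_cosets_u:
  assumes "(M, h) \<in> A_cosets"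
  shows "(M \<circ> e12 f, h * u f) \<in> A_cosets"
proof -
  consider "(M, h) \<in> C_pairs"
    | N k a where "(N, k) \<in> C_pairs" "M = N \<circ> (prod.swap \<circ> e12 [:a:])" "h = k * (S * u [:a:])"
    using assms by (auto simp: A_cosets_def)
  then show ?thesis
  proof cases
    case 1
    then show ?thesis
      using C_mult[OF 1 C_u[OF C_one, of f]] by (simp add: A_cosets_def)
  next
    case 2
    obtain b g where f: "f = pCons b g" by (cases f)
    have af: "[:a:] + f = tvar * g + [:a + b:]"
      by (simp add: f)
    have "(N \<circ> (prod.swap \<circ> (e12 (tvar * g) \<circ> prod.swap)), k * (S * (u (tvar * g) * S))) \<in> C_pairs"
      (is "(?N, ?k) \<in> _")
      using C_mult[OF 2(1) C_l[OF C_one, of g]] by simp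
    moreover have "M \<circ> e12 f = ?N \<circ> (prod.swap \<circ> e12 [:a + b:])"
      using e12_add[of "[:a:]" f] e12_add[of "tvar * g" "[:a + b:]"]
      unfolding af 2 by (simp only: comp_assoc swap_swap)
    moreover have "h * u f = ?k * (S * u [:a + b:])"
      using u_add[of "[:a:]" f] u_add[of "tvar * g" "[:a + b:]"]
      unfolding af 2 by (simp only: mult.assoc SS')
    ultimately show ?thesis unfolding A_cosets_def by blast
  qed
qed

lemma A_cosets_right: "(M, h) \<in> A_pairs \<Longrightarrow> (N, k) \<in> A_cosets \<Longrightarrow> (N \<circ> M, k * h) \<in> A_cosets"
proof (induction arbitrary: N k rule: A_pairs.induct)
  case (A_S M h)
  show ?case using A_S.IH[OF A_cosets_S[OF A_S.prems]] by (simp only: comp_assoc mult.assoc)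
next
  case (A_u M h f)
  show ?case using A_u.IH[OF A_cosets_u[OF A_u.prems]] by (simp only: comp_assoc mult.assoc)
qed simp

lemma A_subset_cosets: "(M, h) \<in> A_pairs \<Longrightarrow> (M, h) \<in> A_cosets"
  using A_cosets_right[of M h id 1] by (simp add: A_cosets_def C_one)

text \<open>Conjugation by \<open>S * D\<close> exchanges the upper unipotent generators with entry
  \<open>f\<close> and the lower ones with entry \<open>t * f\<close>.\<close>

lemma W_C:
  "(M, h) \<in> C_pairs \<Longrightarrow> \<exists>N k. (N, k) \<in> C_pairs \<and>
     prod.swap \<circ> (diag_t1 \<circ> M) = N \<circ> (prod.swap \<circ> diag_t1) \<and> S * (D * h) = k * (S * D)"
proof (induction rule: C_pairs.induct)
  case C_one
  have "prod.swap \<circ> (diag_t1 \<circ> id) = id \<circ> (prod.swap \<circ> diag_t1)" "S * (D * 1) = 1 * (S * D)"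
    by simp_all
  then show ?case using C_pairs.C_one by blast
next
  case (C_u M h f)
  then obtain N k where N: "(N, k) \<in> C_pairs"
    and eq: "prod.swap \<circ> (diag_t1 \<circ> M) = N \<circ> (prod.swap \<circ> diag_t1)" "S * (D * h) = k * (S * D)" by blast
  let ?N = "prod.swap \<circ> (e12 (tvar * f) \<circ> (prod.swap \<circ> N))" and ?k = "S * (u (tvar * f) * (S * k))"
  have "(?N, ?k) \<in> C_pairs" using N by (rule C_l)
  moreover have "prod.swap \<circ> (diag_t1 \<circ> (e12 f \<circ> M)) = ?N \<circ> (prod.swap \<circ> diag_t1)"
  proof -
    have "prod.swap \<circ> (diag_t1 \<circ> (e12 f \<circ> M)) =
      prod.swap \<circ> (e12 (tvar * f) \<circ> (prod.swap \<circ> (prod.swap \<circ> (diag_t1 \<circ> M))))"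
      by (auto simp: fun_eq_iff mat_defs algebra_simps split: prod.splits)
    then show ?thesis unfolding eq by (simp only: comp_assoc)
  qed
  moreover have "S * (D * (u f * h)) = ?k * (S * D)"
  proof -
    have "S * (D * (u f * h)) = S * (u (tvar * f) * (S * (S * (D * h))))"
      by (simp only: SS' Du')
    then show ?thesis unfolding eq by (simp only: mult.assoc)
  qed
  ultimately show ?case by blast
next
  case (C_l M h f)
  then obtain N k where N: "(N, k) \<in> C_pairs"
    and eq: "prod.swap \<circ> (diag_t1 \<circ> M) = N \<circ> (prod.swap \<circ> diag_t1)" "S * (D * h) = k * (S * D)" by blast
  have "(e12 f \<circ> N, u f * k) \<in> C_pairs" using N by (rule C_u)
  moreover have "prod.swap \<circ> (diag_t1 \<circ> (prod.swap \<circ> (e12 (tvar * f) \<circ> (prod.swap \<circ> M)))) =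
      e12 f \<circ> N \<circ> (prod.swap \<circ> diag_t1)"
  proof -
    have "prod.swap \<circ> (diag_t1 \<circ> (prod.swap \<circ> (e12 (tvar * f) \<circ> (prod.swap \<circ> M)))) =
      e12 f \<circ> (prod.swap \<circ> (diag_t1 \<circ> M))"
      by (auto simp: fun_eq_iff mat_defs algebra_simps split: prod.splits)
    then show ?thesis unfolding eq by (simp only: comp_assoc)
  qed
  moreover have "S * (D * (S * (u (tvar * f) * (S * h)))) = u f * k * (S * D)"
  proof -
    have "S * (D * (S * (u (tvar * f) * (S * h)))) = d * (u (tvar * f) * (S * h))"
      by (simp only: SD' SS')
    also have "\<dots> = u f * (d * (S * h))"
      by (simp only: u_t mult.assoc dD')
    also have "\<dots> = u f * (S * (D * h))"
      by (simp only: SD')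
    finally show ?thesis unfolding eq by (simp only: mult.assoc)
  qed
  ultimately show ?case by blast
qed

section \<open>Double coset normal form for all pairs\<close>

inductive_set K_pairs :: "((vec2 \<Rightarrow> vec2) \<times> 'h) set" where
  K_one: "(id, 1) \<in> K_pairs"
| K_step: "(M, h) \<in> K_pairs \<Longrightarrow> (diag_1t \<circ> (e12 [:a:] \<circ> M), d * (u [:a:] * h)) \<in> K_pairs"

text \<open>The exponent \<open>k\<close> counts the factors \<open>d\<close>, so it vanishes only
  for the empty word; \<open>pairs_scalar\<close> recognises the trivial case in this way.\<close>

lemma K_shape:
  "(M, h) \<in> K_pairs \<Longrightarrow>
     \<exists>k g. (\<forall>a b. M (a, b) = (a + g * b, tvar ^ k * b)) \<and> (k = 0 \<longrightarrow> M = id \<and> h = 1)"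
proof (induction rule: K_pairs.induct)
  case K_one
  show ?case by (rule exI[of _ 0], rule exI[of _ 0]) auto
next
  case (K_step M h c)
  then obtain k g where "\<And>a b. M (a, b) = (a + g * b, tvar ^ k * b)" by blast
  then have "(diag_1t \<circ> (e12 [:c:] \<circ> M)) (a, b) = (a + (g + [:c:] * tvar ^ k) * b, tvar ^ Suc k * b)" for a b
    by (simp add: mat_defs algebra_simps)
  then show ?case by blast
qed

text \<open>The scalar has no counterpart in the second component, since matrices count up to powers
  of \<open>t\<close> only.\<close>

definition AKA :: "((vec2 \<Rightarrow> vec2) \<times> 'h) set" where
  "AKA = {(scale (tvar ^ j) \<circ> (M \<circ> (K \<circ> N)), h * (c * k)) | j M h K c N k.
     (M, h) \<in> A_pairs \<and> (K, c) \<in> K_pairs \<and> (N, k) \<in> A_pairs}"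

lemma AKA_A:
  assumes "(M, h) \<in> A_pairs" "(N, k) \<in> AKA"
  shows "(M \<circ> N, h * k) \<in> AKA"
proof -
  obtain j M' h' K c N' k' where *: "(M', h') \<in> A_pairs" "(K, c) \<in> K_pairs" "(N', k') \<in> A_pairs"
    and N: "N = scale (tvar ^ j) \<circ> (M' \<circ> (K \<circ> N'))" "k = h' * (c * k')"
    using assms(2) by (auto simp: AKA_def)
  have "M \<circ> scale (tvar ^ j) = scale (tvar ^ j) \<circ> M"
    using A_bij_linear[OF assms(1)] by (auto simp: fun_eq_iff)
  then have "M \<circ> N = scale (tvar ^ j) \<circ> ((M \<circ> M') \<circ> (K \<circ> N'))"
    by (simp add: N(1) comp_assoc[symmetric])
  moreover have "h * k = (h * h') * (c * k')" by (simp add: N(2) mult.assoc)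
  ultimately show ?thesis
    unfolding AKA_def using * A_mult[OF assms(1) *(1)] by blast
qed

text \<open>If the left factor lies in the subgroup, \<open>S * D\<close> moves past it; it then
  starts a middle factor, or its \<open>D\<close> cancels the leading \<open>d\<close> of the middle
  factor and leaves a scalar \<open>t\<close>. In the other cosets, \<open>S * D * S = d\<close>
  lengthens the middle factor by one step.\<close>

lemma AKA_W:
  assumes "(M, h) \<in> AKA"
  shows "(prod.swap \<circ> (diag_t1 \<circ> M), S * (D * h)) \<in> AKA"
proof -
  obtain j M' h' K c N' k' where *: "(M', h') \<in> A_pairs" "(K, c) \<in> K_pairs" "(N', k') \<in> A_pairs"
    and M: "M = scale (tvar ^ j) \<circ> (M' \<circ> (K \<circ> N'))" "h = h' * (c * k')"
    using assms by (auto simp: AKA_def)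
  have WM: "prod.swap \<circ> (diag_t1 \<circ> M) =
      scale (tvar ^ j) \<circ> (prod.swap \<circ> (diag_t1 \<circ> (M' \<circ> (K \<circ> N'))))"
    by (auto simp: M(1) fun_eq_iff mat_defs algebra_simps split: prod.splits)
  consider "(M', h') \<in> C_pairs"
    | P l a where "(P, l) \<in> C_pairs" "M' = P \<circ> (prod.swap \<circ> e12 [:a:])" "h' = l * (S * u [:a:])"
    using A_subset_cosets[OF *(1)] by (auto simp: A_cosets_def)
  then show ?thesis
  proof cases
    case 1
    then obtain P l where P: "(P, l) \<in> C_pairs"
      and eq: "prod.swap \<circ> (diag_t1 \<circ> M') = P \<circ> (prod.swap \<circ> diag_t1)" "S * (D * h') = l * (S * D)"
      using W_C by blast
    have WM': "prod.swap \<circ> (diag_t1 \<circ> M) = scale (tvar ^ j) \<circ> (P \<circ> (prod.swap \<circ> (diag_t1 \<circ> (K \<circ> N'))))"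
      unfolding WM using fun_cong[OF eq(1)] by (auto simp: fun_eq_iff)
    have Wh: "S * (D * h) = l * (S * (D * (c * k')))"
      unfolding M(2) using arg_cong[OF eq(2), of "\<lambda>y. y * (c * k')"] by (simp only: mult.assoc)
    from *(2) show ?thesis
    proof cases
      case K_one
      have "prod.swap \<circ> (diag_t1 \<circ> M) =
          scale (tvar ^ j) \<circ> (P \<circ> (diag_1t \<circ> (e12 [:0:] \<circ> id) \<circ> (prod.swap \<circ> N')))"
        unfolding WM' K_one by (auto simp: fun_eq_iff mat_defs split: prod.splits)
      moreover have "S * (D * h) = l * (d * (u [:0:] * 1) * (S * k'))"
        unfolding Wh K_one by (simp add: SD' mult.assoc)
      ultimately show ?thesis
        unfolding AKA_def using C_subset_A[OF P] K_step[OF K_pairs.K_one, of 0] A_S[OF *(3)] by blast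
    next
      case (K_step K' c' a)
      have "prod.swap \<circ> (diag_t1 \<circ> M) =
          scale (tvar ^ Suc j) \<circ> (P \<circ> (prod.swap \<circ> (e12 [:a:] \<circ> id)) \<circ> (K' \<circ> N'))"
      proof
        fix v
        have "prod.swap (diag_t1 (diag_1t w)) = scale tvar (prod.swap w)" for w
          by (cases w) (simp add: mat_defs)
        moreover have "scale (tvar ^ j) (scale tvar w) = scale (tvar ^ Suc j) w" for w
          by (cases w) (simp add: mat_defs)
        ultimately show "(prod.swap \<circ> (diag_t1 \<circ> M)) v =
            (scale (tvar ^ Suc j) \<circ> (P \<circ> (prod.swap \<circ> (e12 [:a:] \<circ> id)) \<circ> (K' \<circ> N'))) v"
          using A_bij_linear[OF C_subset_A[OF P]] unfolding WM' K_step
          by (simp only: comp_apply id_apply)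
      qed
      moreover have "S * (D * h) = l * (S * (u [:a:] * 1)) * (c' * k')"
        unfolding Wh K_step by (simp add: Dd' mult.assoc)
      moreover have "(P \<circ> (prod.swap \<circ> (e12 [:a:] \<circ> id)), l * (S * (u [:a:] * 1))) \<in> A_pairs"
        by (intro A_mult C_subset_A[OF P] A_pairs.intros)
      ultimately show ?thesis
        unfolding AKA_def using K_step *(3) by blast
    qed
  next
    case 2
    then obtain Q m where Q: "(Q, m) \<in> C_pairs"
      and eq: "prod.swap \<circ> (diag_t1 \<circ> P) = Q \<circ> (prod.swap \<circ> diag_t1)" "S * (D * l) = m * (S * D)"
      using W_C by blast
    have "prod.swap \<circ> (diag_t1 \<circ> M) = scale (tvar ^ j) \<circ> ((prod.swap \<circ> (diag_t1 \<circ> P)) \<circ> (prod.swap \<circ> (e12 [:a:] \<circ> (K \<circ> N'))))"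
      unfolding WM 2 by (simp only: comp_assoc)
    also have "\<dots> = scale (tvar ^ j) \<circ> (Q \<circ> (diag_1t \<circ> (e12 [:a:] \<circ> K) \<circ> N'))"
      unfolding eq by (auto simp: fun_eq_iff mat_defs split: prod.splits)
    finally have "prod.swap \<circ> (diag_t1 \<circ> M) = \<dots>" .
    moreover have "S * (D * h) = (S * (D * l)) * (S * (u [:a:] * (c * k')))"
      unfolding M(2) 2 by (simp only: mult.assoc)
    then have "S * (D * h) = m * (d * (u [:a:] * c) * k')"
      unfolding eq by (simp only: mult.assoc SD' SS')
    ultimately show ?thesis
      unfolding AKA_def using C_subset_A[OF Q] K_step[OF *(2), of a] *(3) by blast
  qed
qed


lemma AKA_one: "(id, 1) \<in> AKA"
proof -
  have "id = scale (tvar ^ 0) \<circ> (id \<circ> (id \<circ> id))"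
    by (auto simp: fun_eq_iff scale_def)
  moreover have "1 = 1 * (1 * (1 :: 'h))" by simp
  ultimately show ?thesis
    unfolding AKA_def using A_one K_one by blast
qed

text \<open>As \<open>D = S * (S * D)\<close> and \<open>d = S * D * S\<close>, left multiplication
  by \<open>S * D\<close> and by \<open>A_pairs\<close> covers all generators.\<close>

lemma pairs_subset_AKA: "(M, h) \<in> pairs \<Longrightarrow> (M, h) \<in> AKA"
proof (induction rule: pairs.induct)
  case pairs_one
  show ?case by (rule AKA_one)
next
  case (pairs_S M h)
  show ?case using AKA_A[OF A_S[OF A_one] pairs_S.IH] by (simp only: comp_id mult_1_right)
next
  case (pairs_x M h)
  show ?case using AKA_A[OF A_u[OF A_one, of 1] pairs_x.IH] by (simp only: comp_id mult_1_right u_1)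
next
  case (pairs_D M h)
  show ?case
    using AKA_A[OF A_S[OF A_one] AKA_W[OF pairs_D.IH]]
    by (simp only: comp_id mult_1_right swap_swap SS')
next
  case (pairs_d M h)
  have "diag_1t \<circ> M = prod.swap \<circ> (diag_t1 \<circ> (prod.swap \<circ> id \<circ> M))"
    by (auto simp: fun_eq_iff mat_defs split: prod.splits)
  moreover have "d * h = S * (D * (S * 1 * h))"
    by (simp add: SD' SS')
  ultimately show ?case using AKA_W[OF AKA_A[OF A_S[OF A_one] pairs_d.IH]] by (simp only:)
qed

text \<open>Images of \<open>(1, 0)\<close> show that \<open>p\<close> is exactly the scalar
  \<open>t ^ j\<close> of the normal form. The remaining product is the identity, which forces the
  middle factor to be trivial, and \<open>A_id\<close> applies.\<close>

theorem pairs_scalar: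
  assumes "(scale p, h) \<in> pairs" "p \<noteq> 0"
  shows "h = 1"
proof -
  obtain j M l K c N k where A: "(M, l) \<in> A_pairs" "(N, k) \<in> A_pairs" and K: "(K, c) \<in> K_pairs"
    and p: "scale p = scale (tvar ^ j) \<circ> (M \<circ> (K \<circ> N))" and h: "h = l * (c * k)"
    using pairs_subset_AKA[OF assms(1)] by (auto simp: AKA_def)
  obtain n g where shape: "\<And>a b. K (a, b) = (a + g * b, tvar ^ n * b)"
    and n0: "n = 0 \<Longrightarrow> K = id \<and> c = 1"
    using K_shape[OF K] by blast
  have M: "bij M" "\<And>q v. M (scale q v) = scale q (M v)"
    and N: "bij N" "\<And>q v. N (scale q v) = scale q (N v)"
    using A_bij_linear A by auto
  \<comment> \<open>\<open>K\<close> fixes \<open>(1, 0)\<close>, so evaluating both sides at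
    \<open>v\<close> shows that \<open>p\<close> divides \<open>t ^ j\<close>.\<close>
  obtain v where v: "N v = (1, 0)" by (metis N(1) bij_pointE)
  obtain w where w: "M w = v" by (metis M(1) bij_pointE)
  have "M (scale (tvar ^ j) (1, 0)) = scale (tvar ^ j) (M (K (N v)))"
    by (simp only: M v shape) simp
  also have "\<dots> = scale p v"
    using fun_cong[OF p] by simp
  also have "\<dots> = M (scale p w)"
    by (simp only: M w)
  finally have "scale (tvar ^ j) (1, 0) = scale p w"
    using M(1) by (metis bij_is_inj injD)
  then obtain y where y: "tvar ^ j = p * y"
    by (auto simp: scale_def split: prod.splits)
  \<comment> \<open>The converse divisibility: the right-hand side is a multiple of
    \<open>t ^ j\<close>.\<close>
  have "scale p (1, 0) = scale (tvar ^ j) (M (K (N (1, 0))))"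
    using fun_cong[OF p] by simp
  then obtain z where z: "p = tvar ^ j * z"
    by (auto simp: scale_def split: prod.splits)
  have "p * (y * z) = p * y * z"
    by (simp only: mult.assoc)
  also have "\<dots> = p * 1"
    by (simp only: y[symmetric] z[symmetric] mult_1_right)
  finally have "p * (y * z) = p * 1" .
  then have "y * z = 1"
    using assms(2) mult_left_cancel by blast
  then have "y = 1" by (rule bit_poly_unit)
  then have pj: "p = tvar ^ j" using y by simp
  have "scale p v = scale p v' \<longleftrightarrow> v = v'" for v v'
    using assms(2) by (cases v; cases v') (auto simp: scale_def)
  then have MKN: "M (K (N v)) = v" for v
    using fun_cong[OF p, of v] pj by (simp only: comp_apply)
  \<comment> \<open>\<open>K\<close> must be onto, while its second component is always divisible by
    \<open>t ^ n\<close>.\<close>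
  obtain a b where "K (a, b) = (0, 1)"
  proof -
    obtain v1 where "M (0, 1) = v1" by blast
    then have "M (K (N v1)) = M (0, 1)" using MKN by simp
    then have "K (N v1) = (0, 1)" using M(1) by (metis bij_is_inj injD)
    then show ?thesis using that by (metis surj_pair)
  qed
  then have "tvar ^ n * b = 1" by (simp add: shape)
  then have "tvar ^ n = 1" by (rule bit_poly_unit)
  then have "n = 0"
    by (metis degree_1 degree_linear_power degree_monom_eq gr0I monom_eq_1_iff one_neq_zero one_pCons pCons_0_0 zero_neq_one monom_altdef)
  then have "K = id" "c = 1" using n0 by auto
  have "M \<circ> N = id"
    using MKN unfolding \<open>K = id\<close> by (auto simp: fun_eq_iff)
  then show "h = 1"
    using A_id[of "l * k"] A_mult[OF A] h \<open>c = 1\<close> by simp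
qed

lemma pairs_mult: "(M, h) \<in> pairs \<Longrightarrow> (N, k) \<in> pairs \<Longrightarrow> (M \<circ> N, h * k) \<in> pairs"
  by (induction rule: pairs.induct) (simp_all only: comp_assoc mult.assoc id_comp mult_1 pairs.intros)

lemma pairs_linear: "(M, h) \<in> pairs \<Longrightarrow> M (scale p v) = scale p (M v)"
proof (induction rule: pairs.induct)
  case (pairs_S M h)
  then show ?case by (cases "M v") (simp add: scale_def)
qed (auto simp: mat_defs algebra_simps split: prod.splits)

text \<open>The matrix is inverted only up to a power of \<open>t\<close>, as \<open>diag_t1\<close>
  and \<open>diag_1t\<close> multiply to the scalar \<open>t\<close>.\<close>

lemma pairs_inverse:
  "(M, h) \<in> pairs \<Longrightarrow> \<exists>N k j. (N, k) \<in> pairs \<and> (\<forall>v. N (M v) = scale (tvar ^ j) v) \<and> k * h = 1"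
proof -
  have step: "\<exists>N k j. (N, k) \<in> pairs \<and> (\<forall>v. N ((g \<circ> M) v) = scale (tvar ^ j) v) \<and> k * (c * h) = 1"
    if M: "\<exists>N k j. (N, k) \<in> pairs \<and> (\<forall>v. N (M v) = scale (tvar ^ j) v) \<and> k * h = 1"
      and g': "(g', c') \<in> pairs" "\<And>v. g' (g v) = scale (tvar ^ i) v" "c' * c = 1"
    for g g' :: "vec2 \<Rightarrow> vec2" and c c' M h i
  proof -
    obtain N k j where N: "(N, k) \<in> pairs" "\<And>v. N (M v) = scale (tvar ^ j) v" "k * h = 1"
      using M by blast
    have "(N \<circ> g', k * c') \<in> pairs" by (rule pairs_mult[OF N(1) g'(1)])
    moreover have "(N \<circ> g') ((g \<circ> M) v) = scale (tvar ^ (i + j)) v" for v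
    proof -
      have "(N \<circ> g') ((g \<circ> M) v) = scale (tvar ^ i) (scale (tvar ^ j) v)"
        by (simp only: comp_apply g'(2) pairs_linear[OF N(1)] N(2))
      then show ?thesis by (cases v) (simp add: scale_def power_add mult.assoc)
    qed
    moreover have "k * c' * (c * h) = k * (c' * c) * h"
      by (simp only: mult.assoc)
    ultimately show ?thesis
      using g'(3) N(3) by (metis mult_1_right)
  qed
  show "(M, h) \<in> pairs \<Longrightarrow> ?thesis"
  proof (induction rule: pairs.induct)
    case pairs_one
    have "id (id v) = scale (tvar ^ 0) v" for v
      by (cases v) (simp add: scale_def)
    then show ?case using pairs.pairs_one mult_1 by blast
  next
    case (pairs_S M h)
    show ?case
      by (rule step[OF pairs_S.IH pairs.pairs_S[OF pairs_one], of _ 0]) (auto simp: scale_def SS)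
  next
    case (pairs_x M h)
    show ?case
      by (rule step[OF pairs_x.IH pairs.pairs_x[OF pairs_one], of _ 0]) (auto simp: mat_defs xx add.assoc)
  next
    case (pairs_D M h)
    show ?case
      by (rule step[OF pairs_D.IH pairs.pairs_d[OF pairs_one], of _ 1]) (auto simp: mat_defs dD)
  next
    case (pairs_d M h)
    show ?case
      by (rule step[OF pairs_d.IH pairs.pairs_D[OF pairs_one], of _ 1]) (auto simp: mat_defs Dd)
  qed
qed

text \<open>Multiplying by an inverse of \<open>M\<close> up to scalars turns the comparison into
  one with a scalar matrix, to which \<open>pairs_scalar\<close> applies.\<close>

theorem pairs_unique:
  assumes "(M, h) \<in> pairs" "(M', h') \<in> pairs"
    and eq: "\<And>v. scale (tvar ^ m') (M v) = scale (tvar ^ m) (M' v)"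
  shows "h = h'"
proof -
  obtain N k j where N: "(N, k) \<in> pairs" "\<And>v. N (M v) = scale (tvar ^ j) v" "k * h = 1"
    using pairs_inverse[OF assms(1)] by blast
  obtain P l i where P: "(P, l) \<in> pairs" "l * k = 1"
    using pairs_inverse[OF N(1)] by blast
  \<comment> \<open>A left and a right inverse of \<open>k\<close> coincide, so \<open>h\<close> is
    a two-sided inverse of \<open>k\<close>.\<close>
  have l: "l = h"
    by (metis N(3) P(2) mult.assoc mult_1 mult_1_right)
  have eq': "scale (tvar ^ m) ((N \<circ> M') v) = scale (tvar ^ (m' + j)) v" for v
  proof -
    have "scale (tvar ^ m) ((N \<circ> M') v) = N (scale (tvar ^ m') (M v))"
      by (simp only: comp_apply eq pairs_linear[OF N(1)])
    also have "\<dots> = scale (tvar ^ m') (scale (tvar ^ j) v)"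
      by (simp only: pairs_linear[OF N(1)] N(2))
    finally show ?thesis by (cases v) (simp add: scale_def power_add mult.assoc)
  qed
  obtain p q where pq: "(N \<circ> M') (1, 0) = (p, q)" by fastforce
  have p: "tvar ^ m * p = tvar ^ (m' + j)" 
    using eq'[of "(1, 0)"] unfolding pq by (simp add: scale_def)
  have "N \<circ> M' = scale p"
  proof
    fix v
    have "scale (tvar ^ m) ((N \<circ> M') v) = scale (tvar ^ m) (scale p v)"
      unfolding eq' p[symmetric] by (cases v) (simp add: scale_def mult.assoc)
    then show "(N \<circ> M') v = scale p v"
      by (cases v; cases "(N \<circ> M') v") (simp add: scale_def)
  qed
  then have "(scale p, k * h') \<in> pairs"
    using pairs_mult[OF N(1) assms(2)] by simp
  moreover have "p \<noteq> 0" using p by auto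
  ultimately have "k * h' = 1" by (rule pairs_scalar)
  then show ?thesis
    using P(2) l by (metis mult.assoc mult_1 mult_1_right)
qed

end

section \<open>The Andrews-Curtis group\<close>

quotient_type 'a germ = "nat \<Rightarrow> 'a \<Rightarrow> 'a" / "\<lambda>f g. eventually (\<lambda>n. f n = g n) sequentially"
proof (rule equivpI)
  show "reflp (\<lambda>f g. eventually (\<lambda>n. f n = (g n :: 'a \<Rightarrow> 'a)) sequentially)"
    by (rule reflpI) simp
  show "symp (\<lambda>f g. eventually (\<lambda>n. f n = (g n :: 'a \<Rightarrow> 'a)) sequentially)"
    by (rule sympI) (simp add: eq_commute)
  show "transp (\<lambda>f g. eventually (\<lambda>n. f n = (g n :: 'a \<Rightarrow> 'a)) sequentially)"
    by (rule transpI) (auto elim: eventually_elim2)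
qed

instantiation germ :: (type) monoid_mult
begin

lift_definition one_germ :: "'a germ" is "\<lambda>n. id" .

lift_definition times_germ :: "'a germ \<Rightarrow> 'a germ \<Rightarrow> 'a germ" is "\<lambda>f g n. f n \<circ> g n"
  by (auto elim: eventually_elim2)

instance
  by standard (transfer; simp add: comp_assoc)+

end

lemma abs_germ_eq: "abs_germ f = abs_germ g \<longleftrightarrow> eventually (\<lambda>n. f n = g n) sequentially"
  by (simp add: germ.abs_eq_iff)

lemma abs_rep_germ: "abs_germ (rep_germ h) = h"
  by (rule Quotient3_abs_rep[OF Quotient3_germ])

lemma abs_germ_mult: "abs_germ f * abs_germ g = abs_germ (\<lambda>n. f n \<circ> g n)"
  by (simp add: times_germ.abs_eq)

lemma abs_germ_power: "abs_germ f ^ i = abs_germ (\<lambda>n. f n ^^ i)"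
  by (induction i) (simp_all add: abs_germ_mult one_germ.abs_eq o_def id_def)

text \<open>For fixed \<open>i\<close> the commutation holds from \<open>n = i\<close> on; hence the
  germs satisfy the full system although no single index is claimed to.\<close>

interpretation gl2: gl2_relations "abs_germ S_perm" "abs_germ x_perm" "abs_germ D_perm" "abs_germ d_perm"
proof
  fix i :: nat
  have "eventually (\<lambda>n. i \<le> n) sequentially" by (rule eventually_ge_at_top)
  then have "eventually (\<lambda>n. x_perm n \<circ> ((D_perm n ^^ i) \<circ> x_perm n \<circ> (d_perm n ^^ i)) =
      (D_perm n ^^ i) \<circ> x_perm n \<circ> (d_perm n ^^ i) \<circ> x_perm n) sequentially"
    by eventually_elim (rule x_perm_commute)
  then show "abs_germ x_perm * (abs_germ D_perm ^ i * abs_germ x_perm * abs_germ d_perm ^ i) =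
      abs_germ D_perm ^ i * abs_germ x_perm * abs_germ d_perm ^ i * abs_germ x_perm"
    by (simp only: abs_germ_power abs_germ_mult abs_germ_eq)
qed (simp_all only: abs_germ_mult one_germ.abs_eq S_perm_S_perm x_perm_x_perm braid_perm
      D_perm_d_perm S_perm_D_perm id_def[symmetric])

section \<open>Evaluation of tuples in an affine group\<close>

definition affine_group :: "(bit poly fract \<times> bit poly fract) monoid" where
  "affine_group = \<lparr>carrier = {av. fst av \<noteq> 0},
     monoid.mult = (\<lambda>(a, v) (b, w). (a * b, v + a * w)), one = (1, 0)\<rparr>"

lemma group_affine_group: "group affine_group"
proof (rule groupI)
  fix x assume "x \<in> carrier affine_group"
  then show "\<exists>y \<in> carrier affine_group. y \<otimes>\<^bsub>affine_group\<^esub> x = \<one>\<^bsub>affine_group\<^esub>"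
    by (intro bexI[of _ "(inverse (fst x), - inverse (fst x) * snd x)"])
       (auto simp: affine_group_def split: prod.splits)
qed (auto simp: affine_group_def algebra_simps split: prod.splits)

abbreviation (input) \<tau> :: "bit poly fract" where "\<tau> \<equiv> to_fract tvar"

definition transl :: "nat \<Rightarrow> bit poly \<Rightarrow> bit poly fract \<times> bit poly fract" where
  "transl l a = (1, to_fract a / \<tau> ^ l)"

lemma transl_carrier [simp]: "transl l a \<in> carrier affine_group"
  by (simp add: transl_def affine_group_def)

lemma tau_carrier [simp]: "(\<tau>, 0) \<in> carrier affine_group"
  by (simp add: affine_group_def)

lemma transl_mult [simp]: "transl l a \<otimes>\<^bsub>affine_group\<^esub> transl l b = transl l (a + b)"
  by (simp add: transl_def affine_group_def add_divide_distrib)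

lemma transl_inv [simp]: "inv\<^bsub>affine_group\<^esub> transl l a = transl l a"
proof (rule group.inv_equality[OF group_affine_group])
  show "transl l a \<otimes>\<^bsub>affine_group\<^esub> transl l a = \<one>\<^bsub>affine_group\<^esub>"
    by (simp only: transl_mult bit_poly_add_self) (simp add: transl_def affine_group_def)
qed auto

lemma inv_tau: "inv\<^bsub>affine_group\<^esub> (\<tau>, 0) = (inverse \<tau>, 0)"
  by (rule group.inv_equality[OF group_affine_group]) (auto simp: affine_group_def)

lemma transl_conj_tau:
  "(\<tau>, 0) \<otimes>\<^bsub>affine_group\<^esub> transl l a \<otimes>\<^bsub>affine_group\<^esub> inv\<^bsub>affine_group\<^esub> (\<tau>, 0) = transl l (tvar * a)"
  unfolding inv_tau by (simp add: affine_group_def transl_def del: mult_pCons_left) 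

lemma transl_Suc: "transl (Suc l) (tvar * a) = transl l a"
  unfolding transl_def by (simp del: mult_pCons_left)

lemma transl_conj_inv_tau:
  "inv\<^bsub>affine_group\<^esub> (\<tau>, 0) \<otimes>\<^bsub>affine_group\<^esub> transl l a \<otimes>\<^bsub>affine_group\<^esub> (\<tau>, 0) = transl (Suc l) a"
  unfolding inv_tau by (simp add: affine_group_def transl_def field_simps del: mult_pCons_left)

lemma transl_eq: "transl l a = transl m b \<Longrightarrow> tvar ^ m * a = tvar ^ l * b"
proof -
  assume "transl l a = transl m b"
  then have "to_fract a * \<tau> ^ m = to_fract b * \<tau> ^ l"
    by (simp add: transl_def frac_eq_eq)
  moreover have "\<tau> ^ k = to_fract (tvar ^ k)" for k
    by (induction k) (simp_all only: power_0 power_Suc to_fract_1 to_fract_mult)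
  ultimately have "to_fract (a * tvar ^ m) = to_fract (b * tvar ^ l)"
    by simp
  then show ?thesis by (simp only: to_fract_eq_iff mult.commute)
qed


lemma y_gen_carrier: "k \<in> {1..s} \<Longrightarrow> y_gen k \<in> carrier (F_group r s)"
  by (auto simp: y_gen_def F_group_def)

lemma tuples_component: "u \<in> tuples r s \<Longrightarrow> i \<in> {1..r} \<Longrightarrow> u i \<in> carrier (F_group r s)"
  by (auto simp: tuples_def)

lemma tuples_update:
  "u \<in> tuples r s \<Longrightarrow> i \<in> {1..r} \<Longrightarrow> g \<in> carrier (F_group r s) \<Longrightarrow> u(i := g) \<in> tuples r s"
  by (auto simp: tuples_def PiE_iff extensional_def)

text \<open>Used on tuples whose components map to translations: these commute, are their own
  inverses, and are multiplied by \<open>t\<close> under conjugation by each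
  \<open>y_gen k\<close>.\<close>

definition evaluation :: "nat \<Rightarrow> (basis_symbol letter list \<Rightarrow> bit poly fract \<times> bit poly fract) \<Rightarrow> bool" where
  "evaluation s \<pi> \<longleftrightarrow> \<pi> \<in> hom (F_group 2 s) affine_group \<and> (\<forall>k \<in> {1..s}. \<pi> (y_gen k) = (\<tau>, 0))"

text \<open>The evaluated tuple is \<open>t\<^bsup>-l\<^esup> v\<close>, which keeps all vectors polynomial.\<close>

definition has_value where
  "has_value \<pi> u l v \<longleftrightarrow> \<pi> (u 1) = transl l (fst v) \<and> \<pi> (u (2 :: nat)) = transl l (snd v)"

text \<open>In effect \<open>g\<close> acts on values as the matrix \<open>M\<close> divided by
  \<open>t ^ m\<close>; the exponent absorbs the denominators coming from inverses of
  \<open>AC4\<close>.\<close>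

definition represents :: "nat \<Rightarrow> ((nat \<Rightarrow> basis_symbol letter list) \<Rightarrow> (nat \<Rightarrow> basis_symbol letter list)) \<Rightarrow>
    (vec2 \<Rightarrow> vec2) \<Rightarrow> nat \<Rightarrow> bool" where
  "represents s g M m \<longleftrightarrow> (\<forall>\<pi> u l v. evaluation s \<pi> \<longrightarrow> u \<in> tuples 2 s \<longrightarrow> has_value \<pi> u l v \<longrightarrow>
     has_value \<pi> (g u) (l + m) (M v))"

lemma evaluation_mult:
  "evaluation s \<pi> \<Longrightarrow> a \<in> carrier (F_group 2 s) \<Longrightarrow> b \<in> carrier (F_group 2 s) \<Longrightarrow>
    \<pi> (a \<otimes>\<^bsub>F_group 2 s\<^esub> b) = \<pi> a \<otimes>\<^bsub>affine_group\<^esub> \<pi> b"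
  by (auto simp: evaluation_def hom_def)

lemma evaluation_inv:
  assumes "evaluation s \<pi>" "a \<in> carrier (F_group 2 s)"
  shows "\<pi> (inv\<^bsub>F_group 2 s\<^esub> a) = inv\<^bsub>affine_group\<^esub> \<pi> a"
  using group_hom.hom_inv[of "F_group 2 s" affine_group \<pi> a] assms
  by (simp add: group_hom_def group_hom_axioms_def group_F_group group_affine_group evaluation_def)

lemma evaluation_y: "evaluation s \<pi> \<Longrightarrow> k \<in> {1..s} \<Longrightarrow> \<pi> (y_gen k) = (\<tau>, 0)"
  by (simp add: evaluation_def)

section \<open>Matrices of the generators and of their inverses\<close>

lemma inv_Bij_eq:
  assumes "f \<in> Bij T" "\<And>u. u \<in> T \<Longrightarrow> g u \<in> T" "\<And>u. u \<in> T \<Longrightarrow> f (g u) = u" "u \<in> T"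
  shows "(inv\<^bsub>BijGroup T\<^esub> f) u = g u"
proof -
  have "inj_on f T" using assms(1) by (auto simp: Bij_def bij_betw_def)
  then have "inv_into T f (f (g u)) = g u" using assms(2,4) by (intro inv_into_f_f)
  then show ?thesis using assms(1,3,4) by (simp add: inv_BijGroup)
qed

lemma AC_in_Bij: "g \<in> AC_transformations r s \<Longrightarrow> g \<in> Bij (tuples r s)"
  using AC_transformations_subset by (auto simp: BijGroup_def)

context
  fixes s :: nat
begin

interpretation F: group "F_group 2 s" by (rule group_F_group)

abbreviation (input) "GA \<equiv> BijGroup (tuples 2 s)"

lemmas component [simp] = tuples_component[of _ 2 s 1, simplified] tuples_component[of _ 2 s 2, simplified]

lemmas update [simp] = tuples_update[of _ 2 s 1, simplified] tuples_update[of _ 2 s 2, simplified]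

lemmas rep_simps = represents_def has_value_def evaluation_mult evaluation_inv y_gen_carrier evaluation_y
  transl_conj_tau transl_conj_inv_tau transl_Suc e12_def diag_t1_def diag_1t_def

lemma represents_AC1:
  "represents s (AC1 2 s 1 2) (e12 1) 0" "represents s (AC1 2 s 2 1) (prod.swap \<circ> e12 1 \<circ> prod.swap) 0"
  by (auto simp: AC1_def rep_simps add.commute)

lemma represents_AC2:
  "represents s (AC2 2 s 1 2) (e12 1) 0" "represents s (AC2 2 s 2 1) (prod.swap \<circ> e12 1 \<circ> prod.swap) 0"
  by (auto simp: AC2_def rep_simps add.commute)

text \<open>In characteristic two a translation is its own inverse.\<close>

lemma represents_AC3: "i \<in> {1..2} \<Longrightarrow> represents s (AC3 2 s i) id 0"
proof -
  assume "i \<in> {1..2}"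
  then consider "i = 1" | "i = 2" by fastforce
  then show ?thesis by cases (auto simp: AC3_def rep_simps)
qed

lemma represents_AC4:
  assumes "k \<in> {1..s}"
  shows "represents s (AC4 2 s 1 k) diag_t1 0" "represents s (AC4 2 s 2 k) diag_1t 0"
  using assms by (auto simp: AC4_def rep_simps simp del: mult_pCons_left atLeastAtMost_iff)

lemma represents_inv:
  assumes g: "g \<in> AC_transformations 2 s" and M: "represents s g' M m"
    and g': "\<And>u. u \<in> tuples 2 s \<Longrightarrow> g' u \<in> tuples 2 s" "\<And>u. u \<in> tuples 2 s \<Longrightarrow> g (g' u) = u"
  shows "represents s (inv\<^bsub>GA\<^esub> g) M m"
  using M inv_Bij_eq[OF AC_in_Bij[OF g] g'] by (auto simp: represents_def)

text \<open>The matrix is that of \<open>AC1\<close> itself, as \<open>e12 1\<close> is an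
  involution in characteristic two.\<close>

lemma represents_inv_AC1:
  assumes "AC1 2 s i j \<in> AC_transformations 2 s" "i \<in> {1..2}" "j \<in> {1..2}" "i \<noteq> j"
  shows "represents s (inv\<^bsub>GA\<^esub> AC1 2 s i j)
    (if i = 1 then e12 1 else prod.swap \<circ> e12 1 \<circ> prod.swap) 0"
proof (rule represents_inv[OF assms(1)])
  let ?g = "\<lambda>u. u(i := u i \<otimes>\<^bsub>F_group 2 s\<^esub> inv\<^bsub>F_group 2 s\<^esub> u j)"
  have ij: "i = 1 \<and> j = 2 \<or> i = 2 \<and> j = 1" using assms(2-4) by auto
  then show "represents s ?g (if i = 1 then e12 1 else prod.swap \<circ> e12 1 \<circ> prod.swap) 0"
    by (auto simp: rep_simps add.commute)
  show g: "?g u \<in> tuples 2 s" if "u \<in> tuples 2 s" for u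
    using that assms(2,3) by (intro tuples_update F.m_closed F.inv_closed) (simp_all add: tuples_component)
  show "AC1 2 s i j (?g u) = u" if u: "u \<in> tuples 2 s" for u
    using g[OF u] ij u by (elim disjE) (simp_all add: AC1_def F.m_assoc)
qed

lemma represents_inv_AC2:
  assumes "AC2 2 s i j \<in> AC_transformations 2 s" "i \<in> {1..2}" "j \<in> {1..2}" "i \<noteq> j"
  shows "represents s (inv\<^bsub>GA\<^esub> AC2 2 s i j)
    (if i = 1 then e12 1 else prod.swap \<circ> e12 1 \<circ> prod.swap) 0"
proof (rule represents_inv[OF assms(1)])
  let ?g = "\<lambda>u. u(i := inv\<^bsub>F_group 2 s\<^esub> u j \<otimes>\<^bsub>F_group 2 s\<^esub> u i)"
  have ij: "i = 1 \<and> j = 2 \<or> i = 2 \<and> j = 1" using assms(2-4) by auto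
  then show "represents s ?g (if i = 1 then e12 1 else prod.swap \<circ> e12 1 \<circ> prod.swap) 0"
    by (auto simp: rep_simps add.commute)
  show g: "?g u \<in> tuples 2 s" if "u \<in> tuples 2 s" for u
    using that assms(2,3) by (intro tuples_update F.m_closed F.inv_closed) (simp_all add: tuples_component)
  show "AC2 2 s i j (?g u) = u" if u: "u \<in> tuples 2 s" for u
    using g[OF u] ij u by (elim disjE) (simp_all add: AC2_def flip: F.m_assoc)
qed

lemma represents_inv_AC3:
  assumes "AC3 2 s i \<in> AC_transformations 2 s" "i \<in> {1..2}"
  shows "represents s (inv\<^bsub>GA\<^esub> AC3 2 s i) id 0"
proof (rule represents_inv[OF assms(1) represents_AC3[OF assms(2)]])
  show g: "AC3 2 s i u \<in> tuples 2 s" if "u \<in> tuples 2 s" for u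
    unfolding AC3_def using that assms(2)
    by (simp add: tuples_update tuples_component del: atLeastAtMost_iff One_nat_def)
  show "AC3 2 s i (AC3 2 s i u) = u" if u: "u \<in> tuples 2 s" for u
    using g[OF u] u tuples_component[OF u assms(2)] unfolding AC3_def by simp
qed

text \<open>Dividing one component by \<open>t\<close> amounts to multiplying the other by
  \<open>t\<close> and then dividing both by \<open>t\<close>; hence the exponent 1.\<close>

lemma represents_inv_AC4:
  assumes "AC4 2 s i k \<in> AC_transformations 2 s" "i \<in> {1..2}" "k \<in> {1..s}"
  shows "represents s (inv\<^bsub>GA\<^esub> AC4 2 s i k) (if i = 1 then diag_1t else diag_t1) 1"
proof (rule represents_inv[OF assms(1)])
  let ?y = "y_gen k"
  let ?g = "\<lambda>u. u(i := inv\<^bsub>F_group 2 s\<^esub> ?y \<otimes>\<^bsub>F_group 2 s\<^esub> u i \<otimes>\<^bsub>F_group 2 s\<^esub> ?y)"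
  have i: "i = 1 \<or> i = 2" using assms(2) by auto
  have y: "?y \<in> carrier (F_group 2 s)" using assms(3) by (rule y_gen_carrier)
  show "represents s ?g (if i = 1 then diag_1t else diag_t1) 1"
    using i assms(3)
    by (auto simp: rep_simps y simp del: mult_pCons_left atLeastAtMost_iff)
  show g: "?g u \<in> tuples 2 s" if "u \<in> tuples 2 s" for u
    using that assms(2) y by (intro tuples_update F.m_closed F.inv_closed) (simp_all add: tuples_component)
  show "AC4 2 s i k (?g u) = u" if u: "u \<in> tuples 2 s" for u
  proof -
    have ui: "u i \<in> carrier (F_group 2 s)" using tuples_component[OF u assms(2)] .
    then have "?y \<otimes>\<^bsub>F_group 2 s\<^esub> (inv\<^bsub>F_group 2 s\<^esub> ?y \<otimes>\<^bsub>F_group 2 s\<^esub> u i \<otimes>\<^bsub>F_group 2 s\<^esub> ?y)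
        \<otimes>\<^bsub>F_group 2 s\<^esub> inv\<^bsub>F_group 2 s\<^esub> ?y = u i"
      using y by (simp add: F.m_assoc) (simp add: y flip: F.m_assoc)
    then show ?thesis using g[OF u] unfolding AC4_def by simp
  qed
qed


section \<open>The asymptotic homomorphism on the Andrews-Curtis group\<close>

abbreviation (input) "germ_pairs \<equiv> gl2.pairs"

text \<open>Links a transformation to a germ through a common matrix; existence and uniqueness of
  \<open>h\<close> on the group turn this into a homomorphism.\<close>

definition lifts_to where
  "lifts_to g h \<longleftrightarrow> (\<exists>M m. (M, h) \<in> germ_pairs \<and> represents s g M m)"

lemma swap_e12_pairs:
  "(prod.swap \<circ> e12 1 \<circ> prod.swap, abs_germ S_perm * abs_germ x_perm * abs_germ S_perm) \<in> germ_pairs"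
  "(e12 1, abs_germ x_perm) \<in> germ_pairs"
  "(diag_t1, abs_germ D_perm) \<in> germ_pairs"
  "(diag_1t, abs_germ d_perm) \<in> germ_pairs"
  using gl2.pairs_S[OF gl2.pairs_x[OF gl2.pairs_S[OF gl2.pairs_one]]] gl2.pairs_x[OF gl2.pairs_one]
    gl2.pairs_D[OF gl2.pairs_one] gl2.pairs_d[OF gl2.pairs_one]
  by (simp_all only: comp_id mult_1_right comp_assoc mult.assoc)

lemma lifts_toI: "represents s g M m \<Longrightarrow> (M, h) \<in> germ_pairs \<Longrightarrow> lifts_to g h"
  by (auto simp: lifts_to_def)

lemma lifts_to_generator:
  assumes g: "g \<in> AC_transformations 2 s"
  shows "(\<exists>h. lifts_to g h) \<and> (\<exists>h. lifts_to (inv\<^bsub>GA\<^esub> g) h)"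
proof -
  let ?M = "\<lambda>i :: nat. if i = 1 then e12 1 else prod.swap \<circ> e12 1 \<circ> prod.swap"
  let ?h = "\<lambda>i :: nat. if i = 1 then abs_germ x_perm else abs_germ S_perm * abs_germ x_perm * abs_germ S_perm"
  have M: "(?M i, ?h i) \<in> germ_pairs" for i
    using swap_e12_pairs(1,2) by (cases "i = 1") simp_all
  consider i j where "g = AC1 2 s i j" "i \<in> {1..2}" "j \<in> {1..2}" "i \<noteq> j"
    | i j where "g = AC2 2 s i j" "i \<in> {1..2}" "j \<in> {1..2}" "i \<noteq> j"
    | i where "g = AC3 2 s i" "i \<in> {1..2}"
    | i k where "g = AC4 2 s i k" "i \<in> {1..2}" "k \<in> {1..s}"
    using g unfolding AC_transformations_def by blast
  then show ?thesis
  proof cases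
    case 1
    then have "i = 1 \<and> j = 2 \<or> i = 2 \<and> j = 1" by auto
    then have "represents s (AC1 2 s i j) (?M i) 0"
      using represents_AC1 by (elim disjE conjE) simp_all
    with 1 show ?thesis
      using lifts_toI[OF _ M] represents_inv_AC1[OF g[unfolded 1] 1(2-4)] by blast
  next
    case 2
    then have "i = 1 \<and> j = 2 \<or> i = 2 \<and> j = 1" by auto
    then have "represents s (AC2 2 s i j) (?M i) 0"
      using represents_AC2 by (elim disjE conjE) simp_all
    with 2 show ?thesis
      using lifts_toI[OF _ M] represents_inv_AC2[OF g[unfolded 2] 2(2-4)] by blast
  next
    case 3
    then show ?thesis
      using lifts_toI[OF _ gl2.pairs_one] represents_inv_AC3[OF g[unfolded 3] 3(2)] represents_AC3[OF 3(2)]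
      by blast
  next
    case 4
    have inv: "\<exists>h. lifts_to (inv\<^bsub>GA\<^esub> g) h"
      using lifts_toI[OF represents_inv_AC4[OF g[unfolded 4] 4(2,3)]] swap_e12_pairs(3,4) 4(1)
      by (cases "i = 1") auto
    consider "i = 1" | "i = 2" using 4(2) by fastforce
    then have "\<exists>h. lifts_to g h"
      using lifts_toI[OF represents_AC4(1)[OF 4(3)] swap_e12_pairs(3)]
        lifts_toI[OF represents_AC4(2)[OF 4(3)] swap_e12_pairs(4)] 4(1)
      by cases auto
    with inv show ?thesis by blast
  qed
qed

lemma A_group_carrier_Bij: "g \<in> carrier (A_group 2 s) \<Longrightarrow> g \<in> Bij (tuples 2 s)"
  using group.generate_incl[OF group_BijGroup AC_transformations_subset, of 2 s]
  by (auto simp: A_group_def BijGroup_def)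

lemma A_group_mult:
  "g \<in> Bij (tuples 2 s) \<Longrightarrow> h \<in> Bij (tuples 2 s) \<Longrightarrow> g \<otimes>\<^bsub>A_group 2 s\<^esub> h = compose (tuples 2 s) g h"
  by (simp add: A_group_def BijGroup_def)

lemma Bij_closed: "g \<in> Bij T \<Longrightarrow> u \<in> T \<Longrightarrow> g u \<in> T"
  by (auto simp: Bij_def bij_betw_def)

lemma lifts_to_compose:
  assumes "g \<in> Bij (tuples 2 s)" "g' \<in> Bij (tuples 2 s)" "lifts_to g h" "lifts_to g' h'"
  shows "lifts_to (compose (tuples 2 s) g g') (h * h')"
proof -
  obtain M m M' m' where M: "(M, h) \<in> germ_pairs" "represents s g M m"
    and M': "(M', h') \<in> germ_pairs" "represents s g' M' m'"
    using assms(3,4) by (auto simp: lifts_to_def)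
  have "represents s (compose (tuples 2 s) g g') (M \<circ> M') (m' + m)"
    unfolding represents_def
  proof (intro allI impI)
    fix \<pi> u l v assume u: "evaluation s \<pi>" "u \<in> tuples 2 s" "has_value \<pi> u l v"
    then have "has_value \<pi> (g (g' u)) (l + m' + m) (M (M' v))"
      using M(2) M'(2) Bij_closed[OF assms(2)] unfolding represents_def by blast
    then show "has_value \<pi> (compose (tuples 2 s) g g' u) (l + (m' + m)) ((M \<circ> M') v)"
      using u(2) by (simp add: compose_def add.assoc)
  qed
  then show ?thesis
    using gl2.pairs_mult[OF M(1) M'(1)] unfolding lifts_to_def by blast
qed

lemma lifts_to_exists:
  assumes "g \<in> carrier (A_group 2 s)"
  shows "\<exists>h. lifts_to g h"
proof -
  have "g \<in> generate GA (AC_transformations 2 s)" using assms by (simp add: A_group_def)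
  then show ?thesis
  proof (induction rule: generate.induct)
    case one
    have "represents s \<one>\<^bsub>GA\<^esub> id 0" by (auto simp: represents_def BijGroup_def)
    then show ?case using gl2.pairs_one unfolding lifts_to_def by blast
  next
    case (eng g g')
    then have "g \<in> Bij (tuples 2 s)" "g' \<in> Bij (tuples 2 s)"
      using A_group_carrier_Bij by (auto simp: A_group_def)
    moreover from this have "g \<otimes>\<^bsub>GA\<^esub> g' = compose (tuples 2 s) g g'" by (simp add: BijGroup_def)
    ultimately show ?case using eng.IH lifts_to_compose by metis
  qed (use lifts_to_generator in auto)
qed

lemma evaluation_exists:
  obtains \<pi> where "evaluation s \<pi>" "\<pi> (free_gen (Fsym 1)) = transl 0 a" "\<pi> (free_gen (Fsym 2)) = transl 0 b"
proof -
  define \<phi> where "\<phi> c = (case c of Fsym i \<Rightarrow> if i = 1 then transl 0 a else transl 0 b | Ysym k \<Rightarrow> (\<tau>, 0))" for c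
  have "\<phi> \<in> (Fsym ` {1..2} \<union> Ysym ` {1..s}) \<rightarrow> carrier affine_group"
    using tau_carrier by (auto simp: \<phi>_def split: basis_symbol.splits)
  from free_group_universal[OF group_affine_group this]
  obtain \<pi> where \<pi>: "\<pi> \<in> hom (F_group 2 s) affine_group"
    "\<And>c. c \<in> Fsym ` {1..2} \<union> Ysym ` {1..s} \<Longrightarrow> \<pi> (free_gen c) = \<phi> c"
    unfolding F_group_def by blast
  show ?thesis
    by (rule that[of \<pi>]) (use \<pi> in \<open>auto simp: evaluation_def y_gen_def \<phi>_def\<close>)
qed

text \<open>The basis tuple can be given any polynomial values, so \<open>g\<close> determines its
  matrix up to powers of \<open>t\<close>, and thereby the germ.\<close>

lemma lifts_to_unique:
  assumes "lifts_to g h" "lifts_to g h'"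
  shows "h = h'"
proof -
  obtain M m M' m' where M: "(M, h) \<in> germ_pairs" "represents s g M m"
    and M': "(M', h') \<in> germ_pairs" "represents s g M' m'"
    using assms by (auto simp: lifts_to_def)
  have "scale (tvar ^ m') (M v) = scale (tvar ^ m) (M' v)" for v
  proof -
    obtain \<pi> where \<pi>: "evaluation s \<pi>" "\<pi> (free_gen (Fsym 1)) = transl 0 (fst v)"
      "\<pi> (free_gen (Fsym 2)) = transl 0 (snd v)"
      by (rule evaluation_exists)
    define u where "u = (\<lambda>i \<in> {1..2}. free_gen (Fsym i))"
    have u: "u \<in> tuples 2 s" by (auto simp: u_def tuples_def F_group_def)
    have "has_value \<pi> u 0 v" using \<pi> by (auto simp: has_value_def u_def)
    then have "has_value \<pi> (g u) (0 + m) (M v)" "has_value \<pi> (g u) (0 + m') (M' v)"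
      using M(2) M'(2) \<pi>(1) u unfolding represents_def by blast+
    then have "transl m (fst (M v)) = transl m' (fst (M' v))" "transl m (snd (M v)) = transl m' (snd (M' v))"
      by (simp_all add: has_value_def)
    from this[THEN transl_eq] show ?thesis
      by (cases "M v"; cases "M' v") (simp add: scale_def)
  qed
  then show ?thesis by (rule gl2.pairs_unique[OF M(1) M'(1)])
qed

definition asymptotic where
  "asymptotic g = rep_germ (THE h. lifts_to g h)"

lemma asymptotic: "lifts_to g (abs_germ f) \<Longrightarrow> eventually (\<lambda>n. asymptotic g n = f n) sequentially"
proof -
  assume f: "lifts_to g (abs_germ f)"
  then have "(THE h. lifts_to g h) = abs_germ f" using lifts_to_unique by blast
  then have "abs_germ (asymptotic g) = abs_germ f"
    unfolding asymptotic_def by (simp only: abs_rep_germ)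
  then show ?thesis by (simp only: abs_germ_eq)
qed

lemma lifts_to_asymptotic:
  assumes "g \<in> carrier (A_group 2 s)"
  shows "lifts_to g (abs_germ (asymptotic g))"
proof -
  obtain h where h: "lifts_to g h" using lifts_to_exists[OF assms] by blast
  then have "(THE h. lifts_to g h) = h" using lifts_to_unique by blast
  then have "abs_germ (asymptotic g) = h"
    unfolding asymptotic_def by (simp only: abs_rep_germ)
  with h show ?thesis by simp
qed

text \<open>The germ has a left inverse that itself has a left inverse, so it is invertible; a
  two-sided inverse of germs gives inverse maps from some index on.\<close>

lemma asymptotic_bij:
  assumes "g \<in> carrier (A_group 2 s)"
  shows "eventually (\<lambda>n. bij (asymptotic g n)) sequentially"
proof -
  let ?h = "abs_germ (asymptotic g)"
  obtain M where "(M, ?h) \<in> germ_pairs"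
    using lifts_to_asymptotic[OF assms] by (auto simp: lifts_to_def)
  then obtain N k where k: "(N, k) \<in> germ_pairs" "k * ?h = 1" using gl2.pairs_inverse by blast
  obtain l where l: "l * k = 1" using gl2.pairs_inverse[OF k(1)] by blast
  have "l = l * (k * ?h)" using k(2) by simp
  also have "\<dots> = ?h" using l by (simp flip: mult.assoc)
  finally have "?h * k = 1" using l by simp
  moreover obtain f where f: "k = abs_germ f" using abs_rep_germ by metis
  ultimately have "eventually (\<lambda>n. f n \<circ> asymptotic g n = id) sequentially"
    "eventually (\<lambda>n. asymptotic g n \<circ> f n = id) sequentially"
    using k(2) by (simp_all add: abs_germ_mult one_germ.abs_eq abs_germ_eq id_def)
  then show ?thesis by eventually_elim (rule o_bij)
qed

lemma asymptotic_mult: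
  assumes "g \<in> carrier (A_group 2 s)" "h \<in> carrier (A_group 2 s)"
  shows "eventually (\<lambda>n. asymptotic (g \<otimes>\<^bsub>A_group 2 s\<^esub> h) n = asymptotic g n \<circ> asymptotic h n) sequentially"
proof (rule asymptotic)
  show "lifts_to (g \<otimes>\<^bsub>A_group 2 s\<^esub> h) (abs_germ (\<lambda>n. asymptotic g n \<circ> asymptotic h n))"
    using lifts_to_compose[OF _ _ lifts_to_asymptotic lifts_to_asymptotic] assms A_group_carrier_Bij
    by (simp add: A_group_mult abs_germ_mult)
qed

end

lemma AC_in_A_group: "g \<in> AC_transformations r s \<Longrightarrow> g \<in> carrier (A_group r s)"
  by (simp add: A_group_def generate.incl)

section \<open>Commuting transformations\<close>

primrec conj_AC1 where
  "conj_AC1 s 0 = AC1 2 s 1 2"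
| "conj_AC1 s (Suc n) =
    AC4 2 s 1 1 \<otimes>\<^bsub>A_group 2 s\<^esub> conj_AC1 s n \<otimes>\<^bsub>A_group 2 s\<^esub> inv\<^bsub>A_group 2 s\<^esub> AC4 2 s 1 1"

context
  fixes s :: nat
  assumes s: "s \<ge> 1"
begin

interpretation F: group "F_group 2 s" by (rule group_F_group)
interpretation A: group "A_group 2 s" by (rule group_A_group)

lemma gens_in_A_group:
  "AC1 2 s 1 2 \<in> carrier (A_group 2 s)" "AC2 2 s 1 2 \<in> carrier (A_group 2 s)" "AC4 2 s 1 1 \<in> carrier (A_group 2 s)"
proof -
  have "1 \<in> {1..2 :: nat}" "2 \<in> {1..2 :: nat}" "1 \<noteq> (2 :: nat)" "1 \<in> {1..s}" using s by auto
  then show "AC1 2 s 1 2 \<in> carrier (A_group 2 s)" "AC2 2 s 1 2 \<in> carrier (A_group 2 s)"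
    "AC4 2 s 1 1 \<in> carrier (A_group 2 s)"
    by (rule_tac AC_in_A_group, unfold AC_transformations_def, blast)+
qed

lemma conj_AC1_closed: "conj_AC1 s n \<in> carrier (A_group 2 s)"
  using gens_in_A_group by (induction n) auto

lemma A_group_apply:
  "g \<in> carrier (A_group 2 s) \<Longrightarrow> h \<in> carrier (A_group 2 s) \<Longrightarrow> u \<in> tuples 2 s \<Longrightarrow>
    (g \<otimes>\<^bsub>A_group 2 s\<^esub> h) u = g (h u)"
  by (simp add: A_group_mult A_group_carrier_Bij compose_def)

lemma A_group_apply_closed: "g \<in> carrier (A_group 2 s) \<Longrightarrow> u \<in> tuples 2 s \<Longrightarrow> g u \<in> tuples 2 s"
  by (rule Bij_closed[OF A_group_carrier_Bij])

lemma A_group_apply_inv: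
  assumes "g \<in> carrier (A_group 2 s)" "u \<in> tuples 2 s"
  shows "g ((inv\<^bsub>A_group 2 s\<^esub> g) u) = u"
proof -
  have "g ((inv\<^bsub>A_group 2 s\<^esub> g) u) = (g \<otimes>\<^bsub>A_group 2 s\<^esub> inv\<^bsub>A_group 2 s\<^esub> g) u"
    by (rule A_group_apply[symmetric]) (use assms in auto)
  also have "\<dots> = \<one>\<^bsub>A_group 2 s\<^esub> u" using assms by simp
  also have "\<dots> = u" using assms(2) by (simp add: A_group_def BijGroup_def)
  finally show ?thesis .
qed

text \<open>\<open>AC4 2 s 1 1\<close> conjugates the first component alone, so the second one
  enters conjugated by a power of \<open>y_gen 1\<close>, and the multiplication stays on the
  right.\<close>

lemma conj_AC1_apply:
  "u \<in> tuples 2 s \<Longrightarrow> conj_AC1 s n u = u(1 := u 1 \<otimes>\<^bsub>F_group 2 s\<^esub>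
    (y_gen 1 [^]\<^bsub>F_group 2 s\<^esub> n \<otimes>\<^bsub>F_group 2 s\<^esub> u 2 \<otimes>\<^bsub>F_group 2 s\<^esub> inv\<^bsub>F_group 2 s\<^esub> (y_gen 1 [^]\<^bsub>F_group 2 s\<^esub> n)))"
proof (induction n arbitrary: u)
  case 0
  then show ?case using tuples_component[of u 2 s 2] by (simp add: AC1_def)
next
  case (Suc n)
  let ?y = "y_gen 1" and ?D = "AC4 2 s 1 1"
  define c where "c = ?y [^]\<^bsub>F_group 2 s\<^esub> n"
  have y: "?y \<in> carrier (F_group 2 s)" using s by (intro y_gen_carrier) auto
  then have c: "c \<in> carrier (F_group 2 s)" by (simp add: c_def)
  \<comment> \<open>Working from the preimage \<open>v\<close> avoids a formula for the inverse
    transformation.\<close>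
  define v where "v = (inv\<^bsub>A_group 2 s\<^esub> ?D) u"
  have v: "v \<in> tuples 2 s"
    unfolding v_def by (rule A_group_apply_closed[OF A.inv_closed[OF gens_in_A_group(3)] Suc.prems])
  have Dv: "?D v = u"
    unfolding v_def by (rule A_group_apply_inv[OF gens_in_A_group(3) Suc.prems])
  have v12: "v 1 \<in> carrier (F_group 2 s)" "v 2 \<in> carrier (F_group 2 s)"
    using v by (auto intro: tuples_component)
  have u: "u = v(1 := ?y \<otimes>\<^bsub>F_group 2 s\<^esub> v 1 \<otimes>\<^bsub>F_group 2 s\<^esub> inv\<^bsub>F_group 2 s\<^esub> ?y)"
    using Dv v by (simp add: AC4_def)
  have "conj_AC1 s (Suc n) u = (?D \<otimes>\<^bsub>A_group 2 s\<^esub> conj_AC1 s n) v"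
    unfolding v_def conj_AC1.simps
    by (rule A_group_apply[OF A.m_closed[OF gens_in_A_group(3) conj_AC1_closed]
          A.inv_closed[OF gens_in_A_group(3)] Suc.prems])
  also have "\<dots> = ?D (conj_AC1 s n v)"
    by (rule A_group_apply[OF gens_in_A_group(3) conj_AC1_closed v])
  also have "\<dots> = ?D (v(1 := v 1 \<otimes>\<^bsub>F_group 2 s\<^esub> (c \<otimes>\<^bsub>F_group 2 s\<^esub> v 2 \<otimes>\<^bsub>F_group 2 s\<^esub> inv\<^bsub>F_group 2 s\<^esub> c)))"
    by (simp only: Suc.IH[OF v] c_def)
  also have "\<dots> = v(1 := ?y \<otimes>\<^bsub>F_group 2 s\<^esub> (v 1 \<otimes>\<^bsub>F_group 2 s\<^esub> (c \<otimes>\<^bsub>F_group 2 s\<^esub> v 2 \<otimes>\<^bsub>F_group 2 s\<^esub> inv\<^bsub>F_group 2 s\<^esub> c)) \<otimes>\<^bsub>F_group 2 s\<^esub> inv\<^bsub>F_group 2 s\<^esub> ?y)"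
    using tuples_update[OF v, of 1] v12 c by (simp add: AC4_def)
  also have "?y \<otimes>\<^bsub>F_group 2 s\<^esub> (v 1 \<otimes>\<^bsub>F_group 2 s\<^esub> (c \<otimes>\<^bsub>F_group 2 s\<^esub> v 2 \<otimes>\<^bsub>F_group 2 s\<^esub> inv\<^bsub>F_group 2 s\<^esub> c)) \<otimes>\<^bsub>F_group 2 s\<^esub> inv\<^bsub>F_group 2 s\<^esub> ?y
      = (?y \<otimes>\<^bsub>F_group 2 s\<^esub> v 1 \<otimes>\<^bsub>F_group 2 s\<^esub> inv\<^bsub>F_group 2 s\<^esub> ?y) \<otimes>\<^bsub>F_group 2 s\<^esub>
        ((?y \<otimes>\<^bsub>F_group 2 s\<^esub> c) \<otimes>\<^bsub>F_group 2 s\<^esub> v 2 \<otimes>\<^bsub>F_group 2 s\<^esub> inv\<^bsub>F_group 2 s\<^esub> (?y \<otimes>\<^bsub>F_group 2 s\<^esub> c))"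
  proof -
    have "inv\<^bsub>F_group 2 s\<^esub> ?y \<otimes>\<^bsub>F_group 2 s\<^esub> (?y \<otimes>\<^bsub>F_group 2 s\<^esub> g) = g" if "g \<in> carrier (F_group 2 s)" for g
      using y that by (simp flip: F.m_assoc)
    then show ?thesis using y c v12 by (simp add: F.m_assoc F.inv_mult_group)
  qed
  also have "?y \<otimes>\<^bsub>F_group 2 s\<^esub> c = ?y [^]\<^bsub>F_group 2 s\<^esub> Suc n"
    unfolding c_def by (rule F.nat_pow_Suc2[OF y, symmetric])
  also have "?y \<otimes>\<^bsub>F_group 2 s\<^esub> v 1 \<otimes>\<^bsub>F_group 2 s\<^esub> inv\<^bsub>F_group 2 s\<^esub> ?y = u 1"
    by (subst u) simp
  also have "v 2 = u 2"
    by (subst u) simp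
  also have "v(1 := g) = u(1 := g)" for g
    by (subst u) simp
  finally show ?case .
qed

text \<open>Both transformations multiply the first component, from opposite sides, by factors built
  from the second, which neither changes.\<close>

lemma conj_AC1_commute:
  "AC2 2 s 1 2 \<otimes>\<^bsub>A_group 2 s\<^esub> conj_AC1 s n = conj_AC1 s n \<otimes>\<^bsub>A_group 2 s\<^esub> AC2 2 s 1 2"
proof (rule extensionalityI[of _ "tuples 2 s"])
  note closed = gens_in_A_group conj_AC1_closed[of n]
  have ext: "g \<in> extensional (tuples 2 s)" if "g \<in> carrier (A_group 2 s)" for g
    using A_group_carrier_Bij[OF that] by (simp add: Bij_def)
  show "AC2 2 s 1 2 \<otimes>\<^bsub>A_group 2 s\<^esub> conj_AC1 s n \<in> extensional (tuples 2 s)"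
    "conj_AC1 s n \<otimes>\<^bsub>A_group 2 s\<^esub> AC2 2 s 1 2 \<in> extensional (tuples 2 s)"
    using closed by (auto intro: ext)
  fix u assume u: "u \<in> tuples 2 s"
  have y: "y_gen 1 \<in> carrier (F_group 2 s)" using s by (intro y_gen_carrier) auto
  have u12: "u 1 \<in> carrier (F_group 2 s)" "u 2 \<in> carrier (F_group 2 s)"
    using u by (auto intro: tuples_component)
  have AC2: "AC2 2 s 1 2 w = w(1 := w 2 \<otimes>\<^bsub>F_group 2 s\<^esub> w 1)" if "w \<in> tuples 2 s" for w
    using that by (simp add: AC2_def)
  have "(AC2 2 s 1 2 \<otimes>\<^bsub>A_group 2 s\<^esub> conj_AC1 s n) u = AC2 2 s 1 2 (conj_AC1 s n u)"
    using closed u by (simp add: A_group_apply)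
  also have "\<dots> = conj_AC1 s n (AC2 2 s 1 2 u)"
    unfolding AC2[OF A_group_apply_closed[OF closed(4) u]] conj_AC1_apply[OF A_group_apply_closed[OF closed(2) u]]
    unfolding AC2[OF u] conj_AC1_apply[OF u]
    using u12 y by (simp add: F.m_assoc)
  also have "\<dots> = (conj_AC1 s n \<otimes>\<^bsub>A_group 2 s\<^esub> AC2 2 s 1 2) u"
    using closed u by (simp add: A_group_apply)
  finally show "(AC2 2 s 1 2 \<otimes>\<^bsub>A_group 2 s\<^esub> conj_AC1 s n) u = (conj_AC1 s n \<otimes>\<^bsub>A_group 2 s\<^esub> AC2 2 s 1 2) u" .
qed

end

lemma BijGroup_UNIV: "carrier (BijGroup UNIV) = {f. bij f}"
  "bij f \<Longrightarrow> bij g \<Longrightarrow> f \<otimes>\<^bsub>BijGroup UNIV\<^esub> g = f \<circ> g"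
  by (simp_all add: BijGroup_def Bij_def compose_def fun_eq_iff)

theorem theoremB:
  fixes s :: nat
  assumes "s \<ge> 1"
  shows "\<not> finitely_presentable (A_group 2 s)"
proof
  let ?A = "A_group 2 s" and ?H = "BijGroup (UNIV :: (point \<Rightarrow> point) set)"
  \<comment> \<open>The three elements from which both sides of the decisive commutation are
    built.\<close>
  let ?T = "{AC1 2 s 1 2, AC2 2 s 1 2, AC4 2 s 1 1}"
  interpret A: group ?A by (rule group_A_group)
  note gens = gens_in_A_group[OF assms]
  assume fp: "finitely_presentable ?A"
  have "eventually (\<lambda>n. \<exists>\<chi> \<in> hom ?A ?H. \<forall>g \<in> ?T. \<chi> g = asymptotic s g n) sequentially"
  proof (rule finitely_presentable_eventually_hom[OF group_A_group fp group_BijGroup])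
    fix g assume "g \<in> carrier ?A"
    then show "eventually (\<lambda>n. asymptotic s g n \<in> carrier ?H) sequentially"
      using asymptotic_bij by (simp add: BijGroup_UNIV)
    fix h assume h: "h \<in> carrier ?A"
    show "eventually (\<lambda>n. asymptotic s (g \<otimes>\<^bsub>?A\<^esub> h) n =
        asymptotic s g n \<otimes>\<^bsub>?H\<^esub> asymptotic s h n) sequentially"
      using asymptotic_bij[OF \<open>g \<in> carrier ?A\<close>]
        asymptotic_mult[OF \<open>g \<in> carrier ?A\<close> h] asymptotic_bij[OF h] by eventually_elim (simp only: BijGroup_UNIV)
  qed (use gens in auto)
  moreover have "eventually (\<lambda>n. asymptotic s (AC1 2 s 1 2) n = x_perm n) sequentially"
    by (rule asymptotic[OF lifts_toI[OF represents_AC1(1) swap_e12_pairs(2)]])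
  moreover have "eventually (\<lambda>n. asymptotic s (AC2 2 s 1 2) n = x_perm n) sequentially"
    by (rule asymptotic[OF lifts_toI[OF represents_AC2(1) swap_e12_pairs(2)]])
  moreover have "eventually (\<lambda>n. asymptotic s (AC4 2 s 1 1) n = D_perm n) sequentially"
    using assms by (intro asymptotic lifts_toI[OF represents_AC4(1) swap_e12_pairs(3)]) auto
  ultimately have "eventually (\<lambda>n. False) sequentially"
  proof eventually_elim
    case (elim N)
    then obtain \<chi> where \<chi>: "\<chi> \<in> hom ?A ?H" and
      \<chi>_gens: "\<chi> (AC1 2 s 1 2) = x_perm N" "\<chi> (AC2 2 s 1 2) = x_perm N" "\<chi> (AC4 2 s 1 1) = D_perm N"
      by auto
    interpret \<chi>: group_hom ?A ?H \<chi>
      using \<chi> by (simp add: group_hom_def group_hom_axioms_def group_A_group group_BijGroup)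
    have \<chi>_mult: "\<chi> (g \<otimes>\<^bsub>?A\<^esub> h) = \<chi> g \<circ> \<chi> h" if "g \<in> carrier ?A" "h \<in> carrier ?A" for g h
      using that \<chi>.hom_closed by (simp add: BijGroup_UNIV)
    have inv_D: "\<chi> (inv\<^bsub>?A\<^esub> AC4 2 s 1 1) = d_perm N"
    proof -
      have "d_perm N \<otimes>\<^bsub>?H\<^esub> D_perm N = \<one>\<^bsub>?H\<^esub>"
        using D_perm_d_perm(2) by (simp add: BijGroup_UNIV bij_perms) (simp add: BijGroup_def id_def restrict_def)
      then have "inv\<^bsub>?H\<^esub> D_perm N = d_perm N"
        using bij_perms by (intro \<chi>.H.inv_equality) (auto simp: BijGroup_UNIV)
      then show ?thesis using gens by (simp add: \<chi>_gens del: One_nat_def)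
    qed
    have conj: "\<chi> (conj_AC1 s n) = (D_perm N ^^ n) \<circ> x_perm N \<circ> (d_perm N ^^ n)" for n
    proof (induction n)
      case 0
      then show ?case by (simp add: \<chi>_gens del: One_nat_def)
    next
      case (Suc n)
      have "\<chi> (conj_AC1 s (Suc n)) = D_perm N \<circ> ((D_perm N ^^ n) \<circ> x_perm N \<circ> (d_perm N ^^ n)) \<circ> d_perm N"
        using gens conj_AC1_closed[OF assms, of n] 
        by (simp add: \<chi>_mult inv_D \<chi>_gens Suc del: One_nat_def \<chi>.hom_mult \<chi>.hom_inv o_apply)
      then show ?case
        by (simp only: funpow.simps(2)[of _ "D_perm N"] funpow_Suc_right[of _ "d_perm N"] comp_assoc)
    qed
    \<comment> \<open>\<open>Suc N\<close> is the first index beyond the truncation: the commutation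
      holds in the group but fails for the \<open>N\<close>-th permutations.\<close>
    have "\<chi> (AC2 2 s 1 2 \<otimes>\<^bsub>?A\<^esub> conj_AC1 s (Suc N)) = \<chi> (conj_AC1 s (Suc N) \<otimes>\<^bsub>?A\<^esub> AC2 2 s 1 2)"
      by (simp only: conj_AC1_commute[OF assms])
    then have "x_perm N \<circ> \<chi> (conj_AC1 s (Suc N)) = \<chi> (conj_AC1 s (Suc N)) \<circ> x_perm N"
      using gens conj_AC1_closed[OF assms, of "Suc N"] by (simp only: \<chi>_mult \<chi>_gens)
    then show False
      unfolding conj using x_perm_not_commute by blast
  qed
  then show False by simp
qed

end
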